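(* For every formally self-adjoint $Q\in\mathrm{Diff}^1(\mathbb{R})$ and every $N\in\mathbb{N}$ there is a constant $C_N>0$ such that for all $\rho>1$ and every non-trivial eigenfunction $u\in L^2(\mathbb{R})$ of $H(Q)=-\partial_x^2+Q$ with eigenvalue $\rho^2$, $$\frac{\|u\|_{L^\infty(\mathbb{R})}}{\|u\|_{L^2(\mathbb{R})}}\le C_N\rho^{-N}.$$
   Context: $D=-i\partial_x$. $\mathrm{Diff}^1(\mathbb{R})$ is the space of differential operators $Qu=a_1(x)Du+a_0(x)u$ whose coefficients $a_0,a_1$ are smooth and bounded on $\mathbb{R}$ together with all their derivatives. For formally self-adjoint $Q$, $H(Q)$ is self-adjoint on $L^2(\mathbb{R})$ with domain $H^2(\mathbb{R})$. *)

theory Defs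
  imports "HOL-Analysis.Analysis" "HOL-Probability.Essential_Supremum"
begin

text \<open>Elements of \<open>L\<^sup>2\<close> are represented by functions; equality in \<open>L\<^sup>2\<close> is equality almost
  everywhere with respect to Lebesgue measure.\<close>

definition L2 :: "(real \<Rightarrow> complex) set" where
  "L2 = {u. u \<in> borel_measurable lebesgue \<and> integrable lebesgue (\<lambda>x. (norm (u x))\<^sup>2)}"

definition L2_norm :: "(real \<Rightarrow> complex) \<Rightarrow> real" where
  "L2_norm u = sqrt (LINT x|lebesgue. (norm (u x))\<^sup>2)"

definition Linf_norm :: "(real \<Rightarrow> complex) \<Rightarrow> ereal" where
  "Linf_norm u = esssup lebesgue (\<lambda>x. ereal (norm (u x)))"

definition nth_deriv :: "nat \<Rightarrow> (real \<Rightarrow> complex) \<Rightarrow> real \<Rightarrow> complex" where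
  "nth_deriv k f = ((\<lambda>g x. vector_derivative g (at x)) ^^ k) f"

definition smooth :: "(real \<Rightarrow> complex) \<Rightarrow> bool" where
  "smooth f \<longleftrightarrow> (\<forall>k x. nth_deriv k f differentiable (at x))"

definition smooth_bounded :: "(real \<Rightarrow> complex) \<Rightarrow> bool" where
  "smooth_bounded f \<longleftrightarrow> smooth f \<and> (\<forall>k. bounded (range (nth_deriv k f)))"

definition test_function :: "(real \<Rightarrow> complex) \<Rightarrow> bool" where
  "test_function \<phi> \<longleftrightarrow> smooth \<phi> \<and> compact (closure {x. \<phi> x \<noteq> 0})"

definition locally_integrable :: "(real \<Rightarrow> complex) \<Rightarrow> bool" where
  "locally_integrable u \<longleftrightarrow> (\<forall>K. compact K \<longrightarrow> set_integrable lebesgue K u)"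

definition has_weak_deriv :: "(real \<Rightarrow> complex) \<Rightarrow> (real \<Rightarrow> complex) \<Rightarrow> bool" where
  "has_weak_deriv u v \<longleftrightarrow> locally_integrable u \<and> locally_integrable v \<and>
     (\<forall>\<phi>. test_function \<phi> \<longrightarrow>
        (LINT x|lebesgue. u x * vector_derivative \<phi> (at x)) = - (LINT x|lebesgue. v x * \<phi> x))"

text \<open>The weak derivative, when it exists, is unique up to a null set, so \<open>weak_deriv\<close> picks a
  representative of it; for continuously differentiable functions it agrees almost everywhere
  with the classical derivative. Its value is irrelevant when no weak derivative exists.\<close>

definition weak_deriv :: "(real \<Rightarrow> complex) \<Rightarrow> real \<Rightarrow> complex" where
  "weak_deriv u = (SOME v. has_weak_deriv u v)"

definition H2 :: "(real \<Rightarrow> complex) set" where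
  "H2 = {u \<in> L2. \<exists>v\<in>L2. \<exists>w\<in>L2. has_weak_deriv u v \<and> has_weak_deriv v w}"

definition Dx :: "(real \<Rightarrow> complex) \<Rightarrow> real \<Rightarrow> complex" where
  "Dx u x = - \<i> * weak_deriv u x"

definition Diff1 :: "((real \<Rightarrow> complex) \<Rightarrow> real \<Rightarrow> complex) set" where
  "Diff1 = {Q. \<exists>a1 a0. smooth_bounded a1 \<and> smooth_bounded a0 \<and>
                 Q = (\<lambda>u x. a1 x * Dx u x + a0 x * u x)}"

definition formally_self_adjoint :: "((real \<Rightarrow> complex) \<Rightarrow> real \<Rightarrow> complex) \<Rightarrow> bool" where
  "formally_self_adjoint Q \<longleftrightarrow> (\<forall>\<phi> \<psi>. test_function \<phi> \<longrightarrow> test_function \<psi> \<longrightarrow>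
     (LINT x|lebesgue. Q \<phi> x * cnj (\<psi> x)) = (LINT x|lebesgue. \<phi> x * cnj (Q \<psi> x)))"

text \<open>\<open>H Q\<close> is meaningful on its domain \<open>H2\<close>; restriction to the domain is imposed in
  \<open>eigenfunction\<close>.\<close>

definition H :: "((real \<Rightarrow> complex) \<Rightarrow> real \<Rightarrow> complex) \<Rightarrow> (real \<Rightarrow> complex) \<Rightarrow> real \<Rightarrow> complex" where
  "H Q u x = - weak_deriv (weak_deriv u) x + Q u x"

definition nontrivial_eigenfunction ::
  "((real \<Rightarrow> complex) \<Rightarrow> real \<Rightarrow> complex) \<Rightarrow> complex \<Rightarrow> (real \<Rightarrow> complex) \<Rightarrow> bool" where
  "nontrivial_eigenfunction A z u \<longleftrightarrow>
     u \<in> H2 \<and> \<not> (AE x in lebesgue. u x = 0) \<and> (AE x in lebesgue. A u x = z * u x)"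

end

theory Submission
  imports Defs
begin

text \<open>
  Write \<open>\<Lambda> = \<rho>\<^sup>2\<close>. Self-adjointness of \<open>Q = a\<^sub>1 D + a\<^sub>0\<close> forces \<open>a\<^sub>1\<close> to be real and
  \<open>Im a\<^sub>0 = - a\<^sub>1' / 2\<close>. With \<open>b = a\<^sub>1 / 2\<close> and the covariant derivative \<open>W = U' + i b U\<close>, the eigenvalue
  equation becomes the system \<open>U' = W - i b U\<close>, \<open>W' = (V - \<Lambda>) U - i b W\<close> with the real potential
  \<open>V = Re a\<^sub>0 - b\<^sup>2\<close>, which is bounded together with all its derivatives. The terms in \<open>b\<close> are a rotation
  common to \<open>U\<close> and \<open>W\<close>, so they disappear from every Hermitian quadratic form in \<open>(U, W)\<close>.

  At high energy such a system has an adiabatic invariant. For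
  \<open>E = p |U|\<^sup>2 + 2 q Re (cnj U W) + r |W|\<^sup>2\<close> choose \<open>q = - r' / 2\<close> and \<open>p = r'' / 2 - r (V - \<Lambda>)\<close>; then
  \<open>E' = G |U|\<^sup>2\<close>, where \<open>r G\<close> is the derivative of the discriminant
  \<open>F = p r - q\<^sup>2 = r r'' / 2 - r'\<^sup>2 / 4 - r\<^sup>2 (V - \<Lambda>)\<close>. The equation \<open>F = \<Lambda>\<close> is solved to any order in
  \<open>\<epsilon> = 1 / \<Lambda>\<close> by a function \<open>r = 1 + O(\<epsilon>)\<close> (lemma \<open>adiabatic_expansion\<close>), algebraically and without
  integration, so all errors stay bounded on the whole line. This gives \<open>G = O(\<epsilon>\<^sup>K)\<close> for every \<open>K\<close>.
  Since \<open>U\<close> and \<open>W\<close> are square integrable, \<open>E\<close> is integrable, hence \<open>|E|\<close> is at most the integral of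
  \<open>|E'|\<close>, which is \<open>O(\<epsilon>\<^sup>K)\<close> times the squared \<open>L\<^sup>2\<close> norm of \<open>U\<close>. On the other hand
  \<open>r E = F |U|\<^sup>2 + |r W + q U|\<^sup>2\<close> dominates a multiple of \<open>\<Lambda> |U|\<^sup>2\<close>. Together these bound \<open>|U|\<^sup>2\<close> by a
  constant times \<open>\<epsilon>\<^bsup>K + 1\<^esup>\<close> times the squared norm (lemma \<open>sup_bound_large_energy\<close>). For the remaining bounded range of
  energies an elementary Sobolev bound suffices (lemma \<open>sup_bound_bounded_energy\<close>).

  Eigenfunctions are only given in \<open>H\<^sup>2\<close>, up to null sets and with weak derivatives. Lemma
  \<open>has_weak_deriv_imp_primitive\<close> says that a function with a weak derivative is almost everywhere a
  constant plus the integral of that derivative; used twice, together with the equation, it provides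
  a representative that solves the system classically (lemma \<open>eigenfunction_regular\<close>).
\<close>

section \<open>Families of functions with uniform bounds on all derivatives\<close>

text \<open>The index \<open>e\<close> is a parameter, later the small number \<open>\<epsilon>\<close> of the expansion: the bounds are uniform
  in \<open>e\<close> as well as in \<open>x\<close>. Derivatives are quantified existentially, so that closure under products
  is a plain induction on the order.\<close>

primrec uniformly_Ck :: "'e set \<Rightarrow> nat \<Rightarrow> ('e \<Rightarrow> real \<Rightarrow> 'a::real_normed_field) \<Rightarrow> bool" where
  "uniformly_Ck I 0 f \<longleftrightarrow> (\<exists>M. \<forall>e\<in>I. \<forall>x. norm (f e x) \<le> M)"
| "uniformly_Ck I (Suc n) f \<longleftrightarrow> (\<exists>M. \<forall>e\<in>I. \<forall>x. norm (f e x) \<le> M) \<and>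
     (\<exists>g. (\<forall>e\<in>I. \<forall>x. (f e has_vector_derivative g e x) (at x)) \<and> uniformly_Ck I n g)"

definition uniformly_smooth :: "'e set \<Rightarrow> ('e \<Rightarrow> real \<Rightarrow> 'a::real_normed_field) \<Rightarrow> bool" where
  "uniformly_smooth I f \<longleftrightarrow> (\<forall>n. uniformly_Ck I n f)"

lemma uniformly_Ck_cong:
  "(\<And>e. e \<in> I \<Longrightarrow> f e = g e) \<Longrightarrow> uniformly_Ck I n f \<longleftrightarrow> uniformly_Ck I n g"
  by (cases n) auto

lemma uniformly_Ck_bounded: "uniformly_Ck I n f \<Longrightarrow> \<exists>M. \<forall>e\<in>I. \<forall>x. norm (f e x) \<le> M"
  by (cases n) auto

lemma uniformly_Ck_SucD: "uniformly_Ck I (Suc n) f \<Longrightarrow> uniformly_Ck I n f"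
  by (induction n arbitrary: f) (use uniformly_Ck_bounded in \<open>auto\<close>)

lemma uniformly_smooth_bounded:
  assumes "uniformly_smooth I f"
  obtains M where "M > 0" "\<And>e x. e \<in> I \<Longrightarrow> norm (f e x) \<le> M"
proof -
  obtain M where "\<forall>e\<in>I. \<forall>x. norm (f e x) \<le> M"
    using assms uniformly_Ck_bounded unfolding uniformly_smooth_def by blast
  then show ?thesis
    by (intro that[of "max M 1"]) (auto simp: le_max_iff_disj)
qed

text \<open>The derivatives obtained for the different orders agree on \<open>I\<close>, because each of them is the
  vector derivative; hence a single family serves all orders.\<close>

lemma uniformly_smooth_has_derivative:
  assumes "uniformly_smooth I f"
  obtains g where "\<And>e x. e \<in> I \<Longrightarrow> (f e has_vector_derivative g e x) (at x)" "uniformly_smooth I g"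
proof -
  define g where "g e x = vector_derivative (f e) (at x)" for e x
  have *: "(\<forall>e\<in>I. \<forall>x. (f e has_vector_derivative g e x) (at x)) \<and> uniformly_Ck I n g" for n
  proof -
    have "uniformly_Ck I (Suc n) f"
      using assms by (simp only: uniformly_smooth_def)
    then obtain h where h: "\<forall>e\<in>I. \<forall>x. (f e has_vector_derivative h e x) (at x)" "uniformly_Ck I n h"
      by auto
    then have "g e = h e" if "e \<in> I" for e
      using that by (auto simp: g_def fun_eq_iff vector_derivative_at)
    then show ?thesis
      using h uniformly_Ck_cong[of I g h n] by simp
  qed
  then show ?thesis
    using that[of g] by (auto simp: uniformly_smooth_def)
qed

lemma uniformly_smooth_has_real_derivative:
  fixes f :: "'e \<Rightarrow> real \<Rightarrow> real"
  assumes "uniformly_smooth I f"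
  obtains g where "\<And>e x. e \<in> I \<Longrightarrow> (f e has_real_derivative g e x) (at x)" "uniformly_smooth I g"
  using uniformly_smooth_has_derivative[OF assms]
  unfolding has_real_derivative_iff_has_vector_derivative by blast

lemma uniformly_smooth_const:
  assumes "\<And>e. e \<in> I \<Longrightarrow> norm (c e) \<le> M"
  shows "uniformly_smooth I (\<lambda>e x. c e)"
proof -
  have 0: "uniformly_Ck I n (\<lambda>e x. 0)" for n
    by (induction n) (auto intro!: exI[of _ "\<lambda>e x. 0"])
  have "uniformly_Ck I n (\<lambda>e x. c e)" for n
    using assms 0 by (cases n) (auto intro!: exI[of _ "\<lambda>e x. 0"])
  then show ?thesis by (simp add: uniformly_smooth_def)
qed

lemma uniformly_Ck_add:
  "uniformly_Ck I n f \<Longrightarrow> uniformly_Ck I n g \<Longrightarrow> uniformly_Ck I n (\<lambda>e x. f e x + g e x)"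
proof (induction n arbitrary: f g)
  case 0
  then obtain A B where "\<forall>e\<in>I. \<forall>x. norm (f e x) \<le> A" "\<forall>e\<in>I. \<forall>x. norm (g e x) \<le> B" by auto
  then have "\<forall>e\<in>I. \<forall>x. norm (f e x + g e x) \<le> A + B"
    by (auto intro: norm_triangle_mono)
  then show ?case by auto
next
  case (Suc n)
  obtain A B where "\<forall>e\<in>I. \<forall>x. norm (f e x) \<le> A" "\<forall>e\<in>I. \<forall>x. norm (g e x) \<le> B"
    using Suc.prems by auto
  then have "\<forall>e\<in>I. \<forall>x. norm (f e x + g e x) \<le> A + B"
    by (auto intro: norm_triangle_mono)
  moreover obtain f' g' where
    "\<forall>e\<in>I. \<forall>x. (f e has_vector_derivative f' e x) (at x)" "uniformly_Ck I n f'"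
    "\<forall>e\<in>I. \<forall>x. (g e has_vector_derivative g' e x) (at x)" "uniformly_Ck I n g'"
    using Suc.prems by auto
  ultimately show ?case
    using Suc.IH[of f' g']
    by (auto intro!: exI[of _ "\<lambda>e x. f' e x + g' e x"] derivative_eq_intros)
qed

lemma norm_mult_bound:
  fixes y z :: "'a::real_normed_field"
  shows "norm y \<le> A \<Longrightarrow> norm z \<le> B \<Longrightarrow> norm (y * z) \<le> A * B"
  unfolding norm_mult by (intro mult_mono) (auto intro: order_trans[OF norm_ge_zero])

lemma uniformly_Ck_mult:
  "uniformly_Ck I n f \<Longrightarrow> uniformly_Ck I n g \<Longrightarrow> uniformly_Ck I n (\<lambda>e x. f e x * g e x)"
proof (induction n arbitrary: f g)
  case 0
  then obtain A B where "\<forall>e\<in>I. \<forall>x. norm (f e x) \<le> A" "\<forall>e\<in>I. \<forall>x. norm (g e x) \<le> B" by auto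
  then have "\<forall>e\<in>I. \<forall>x. norm (f e x * g e x) \<le> A * B"
    by (auto intro: norm_mult_bound)
  then show ?case by auto
next
  case (Suc n)
  obtain A B where "\<forall>e\<in>I. \<forall>x. norm (f e x) \<le> A" "\<forall>e\<in>I. \<forall>x. norm (g e x) \<le> B"
    using Suc.prems by auto
  then have "\<forall>e\<in>I. \<forall>x. norm (f e x * g e x) \<le> A * B"
    by (auto intro: norm_mult_bound)
  moreover obtain f' g' where
    "\<forall>e\<in>I. \<forall>x. (f e has_vector_derivative f' e x) (at x)" "uniformly_Ck I n f'"
    "\<forall>e\<in>I. \<forall>x. (g e has_vector_derivative g' e x) (at x)" "uniformly_Ck I n g'"
    using Suc.prems by auto
  moreover have "uniformly_Ck I n f" "uniformly_Ck I n g"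
    using Suc.prems uniformly_Ck_SucD by blast+
  ultimately show ?case
    using uniformly_Ck_add[OF Suc.IH[of f g'] Suc.IH[of f' g]]
    by (auto intro!: exI[of _ "\<lambda>e x. f e x * g' e x + f' e x * g e x"] has_vector_derivative_mult)
qed

lemma uniformly_smooth_add:
  "uniformly_smooth I f \<Longrightarrow> uniformly_smooth I g \<Longrightarrow> uniformly_smooth I (\<lambda>e x. f e x + g e x)"
  by (simp add: uniformly_smooth_def uniformly_Ck_add)

lemma uniformly_smooth_mult:
  "uniformly_smooth I f \<Longrightarrow> uniformly_smooth I g \<Longrightarrow> uniformly_smooth I (\<lambda>e x. f e x * g e x)"
  by (simp add: uniformly_smooth_def uniformly_Ck_mult)

lemma uniformly_smooth_diff:
  assumes "uniformly_smooth I f" "uniformly_smooth I g"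
  shows "uniformly_smooth I (\<lambda>e x. f e x - g e x)"
proof -
  have "uniformly_smooth I (\<lambda>e x. f e x + (-1) * g e x)"
    by (intro uniformly_smooth_add uniformly_smooth_mult uniformly_smooth_const[of _ _ 1] assms) simp
  then show ?thesis by simp
qed

lemma uniformly_Ck_bounded_linear:
  assumes "bounded_linear L"
  shows "uniformly_Ck I n f \<Longrightarrow> uniformly_Ck I n (\<lambda>e x. L (f e x))"
proof -
  interpret bounded_linear L by fact
  obtain K where K: "K > 0" "\<And>z. norm (L z) \<le> norm z * K"
    using pos_bounded by blast
  have bd: "\<exists>M. \<forall>e\<in>I. \<forall>x. norm (L (f e x)) \<le> M" if "\<exists>M. \<forall>e\<in>I. \<forall>x. norm (f e x) \<le> M" for f
  proof -
    from that obtain M where "\<forall>e\<in>I. \<forall>x. norm (f e x) \<le> M" by blast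
    then have "\<forall>e\<in>I. \<forall>x. norm (L (f e x)) \<le> M * K"
      using K by (meson mult_right_mono less_imp_le order_trans)
    then show ?thesis by blast
  qed
  show "uniformly_Ck I n f \<Longrightarrow> uniformly_Ck I n (\<lambda>e x. L (f e x))"
  proof (induction n arbitrary: f)
    case 0
    then show ?case using bd[of f] by simp
  next
    case (Suc n)
    obtain f' where "\<forall>e\<in>I. \<forall>x. (f e has_vector_derivative f' e x) (at x)" "uniformly_Ck I n f'"
      using Suc.prems by auto
    then show ?case
      using bd[of f] Suc by (auto intro!: exI[of _ "\<lambda>e x. L (f' e x)"] has_vector_derivative)
  qed
qed

lemma uniformly_smooth_bounded_linear:
  "bounded_linear L \<Longrightarrow> uniformly_smooth I f \<Longrightarrow> uniformly_smooth I (\<lambda>e x. L (f e x))"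
  by (simp add: uniformly_smooth_def uniformly_Ck_bounded_linear)

lemma nth_deriv_0: "nth_deriv 0 f = f"
  by (simp add: nth_deriv_def)

lemma nth_deriv_Suc: "nth_deriv (Suc k) f = nth_deriv k (\<lambda>x. vector_derivative f (at x))"
  unfolding nth_deriv_def funpow_Suc_right by simp

lemma smooth_bounded_deriv:
  assumes "smooth_bounded f"
  shows "(f has_vector_derivative vector_derivative f (at x)) (at x)"
    and "smooth_bounded (\<lambda>x. vector_derivative f (at x))"
proof -
  have "f differentiable at x"
    using assms by (metis nth_deriv_0 smooth_bounded_def smooth_def)
  then show "(f has_vector_derivative vector_derivative f (at x)) (at x)"
    by (simp add: vector_derivative_works)
  show "smooth_bounded (\<lambda>x. vector_derivative f (at x))"
    using assms by (metis nth_deriv_Suc smooth_bounded_def smooth_def)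
qed

lemma smooth_bounded_imp_uniformly_smooth:
  assumes "smooth_bounded f"
  shows "uniformly_smooth I (\<lambda>_. f)"
proof -
  have bd: "\<exists>M. \<forall>x. norm (f x) \<le> M" if "smooth_bounded f" for f
    using that nth_deriv_0[of f] unfolding smooth_bounded_def bounded_iff by (metis rangeI)
  have "uniformly_Ck I n (\<lambda>_. f)" for n
    using assms
  proof (induction n arbitrary: f)
    case 0
    then show ?case using bd by auto
  next
    case (Suc n)
    show ?case
      using bd[OF Suc.prems] smooth_bounded_deriv[OF Suc.prems] Suc.IH
      by (auto intro!: exI[of _ "\<lambda>_ x. vector_derivative f (at x)"])
  qed
  then show ?thesis by (simp add: uniformly_smooth_def)
qed

lemma uniformly_smooth_imp_smooth:
  fixes f :: "real \<Rightarrow> complex"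
  assumes "uniformly_smooth {()} (\<lambda>_. f)"
  shows "smooth f"
proof -
  have "nth_deriv k f differentiable at x" for k x
    using assms
  proof (induction k arbitrary: f)
    case 0
    obtain g where "\<And>e x. e \<in> {()} \<Longrightarrow> (f has_vector_derivative g e x) (at x)"
      by (rule uniformly_smooth_has_derivative[OF "0.prems"]) blast
    then show ?case
      using nth_deriv_0 by (metis differentiableI_vector insertI1)
  next
    case (Suc k)
    obtain g where g: "\<And>e x. e \<in> {()} \<Longrightarrow> (f has_vector_derivative g e x) (at x)"
      "uniformly_smooth {()} g"
      by (rule uniformly_smooth_has_derivative[OF Suc.prems]) blast
    have "g = (\<lambda>_ x. vector_derivative f (at x))"
      by (intro ext) (rule vector_derivative_at[OF g(1), symmetric], simp)
    then show ?case
      using Suc.IH g(2) by (simp add: nth_deriv_Suc)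
  qed
  then show ?thesis by (simp add: smooth_def)
qed

lemma smooth_from_derivative:
  assumes "\<And>x. (f has_vector_derivative g x) (at x)" "smooth g"
  shows "smooth f"
proof -
  have g: "(\<lambda>x. vector_derivative f (at x)) = g"
    using assms(1) by (auto simp: vector_derivative_at)
  have "nth_deriv k f differentiable at x" for k x
    using assms(2) differentiableI_vector[OF assms(1)] g
    by (cases k) (simp_all add: nth_deriv_0 nth_deriv_Suc smooth_def)
  then show ?thesis by (simp add: smooth_def)
qed

lemma smooth_imp_continuous:
  assumes "smooth f" shows "continuous_on UNIV f"
proof -
  have "f differentiable at x" for x
    using assms nth_deriv_0 unfolding smooth_def by metis
  then show ?thesis
    by (simp add: continuous_on_eq_continuous_at differentiable_imp_continuous_within)
qed

section \<open>The adiabatic expansion\<close>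

text \<open>The equation \<open>F = \<Lambda>\<close> for \<open>r = 1 + \<epsilon> t\<close>, divided by \<open>\<Lambda>\<close>, reads
  \<open>\<epsilon> (r r'' / 2 - r'\<^sup>2 / 4 - V r\<^sup>2) + r\<^sup>2 - 1 = 0\<close>. If it holds up to \<open>\<delta> s\<close>, where \<open>\<delta>\<close> is a power of \<open>\<epsilon>\<close>,
  replace \<open>r\<close> by \<open>r - \<delta> s / 2\<close>: the change of \<open>r\<^sup>2\<close> cancels the defect because \<open>r\<close> is close to \<open>1\<close>, and
  everything else carries a further factor \<open>\<epsilon>\<close>. The step only multiplies and differentiates, so it
  stays among uniformly smooth families.\<close>

lemma adiabatic_expansion:
  fixes V :: "real \<Rightarrow> real"
  assumes "uniformly_smooth {0..1} (\<lambda>_::real. V)"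
  shows "\<exists>t t1 t2 s. uniformly_smooth {0..1} t \<and> uniformly_smooth {0..1} t1 \<and>
    uniformly_smooth {0..1} t2 \<and> uniformly_smooth {0..1::real} s \<and>
    (\<forall>\<epsilon>\<in>{0..1}. \<forall>x. (t \<epsilon> has_real_derivative t1 \<epsilon> x) (at x) \<and>
       (t1 \<epsilon> has_real_derivative t2 \<epsilon> x) (at x) \<and>
       \<epsilon> * ((1 + \<epsilon> * t \<epsilon> x) * (\<epsilon> * t2 \<epsilon> x) / 2 - (\<epsilon> * t1 \<epsilon> x)\<^sup>2 / 4 - V x * (1 + \<epsilon> * t \<epsilon> x)\<^sup>2)
         + (1 + \<epsilon> * t \<epsilon> x)\<^sup>2 - 1 = \<epsilon> ^ Suc K * s \<epsilon> x)"
proof (induction K)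
  case 0
  have 0: "uniformly_smooth {0..1} (\<lambda>\<epsilon>::real. \<lambda>x. 0::real)"
    by (rule uniformly_smooth_const[of _ _ 0]) simp
  have "uniformly_smooth {0..1} (\<lambda>\<epsilon>::real. \<lambda>x. 0 - V x)"
    by (intro uniformly_smooth_diff 0 assms)
  with 0 show ?case
    by (intro exI[of _ "\<lambda>\<epsilon> x. 0"] exI[of _ "\<lambda>\<epsilon> x. 0 - V x"]) auto
next
  case (Suc K)
  then obtain t t1 t2 s where us: "uniformly_smooth {0..1} t" "uniformly_smooth {0..1} t1"
    "uniformly_smooth {0..1} t2" "uniformly_smooth {0..1::real} s"
    and d: "\<And>\<epsilon> x. \<epsilon> \<in> {0..1} \<Longrightarrow> (t \<epsilon> has_real_derivative t1 \<epsilon> x) (at x)"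
      "\<And>\<epsilon> x. \<epsilon> \<in> {0..1} \<Longrightarrow> (t1 \<epsilon> has_real_derivative t2 \<epsilon> x) (at x)"
    and eq: "\<And>\<epsilon> x. \<epsilon> \<in> {0..1} \<Longrightarrow>
       \<epsilon> * ((1 + \<epsilon> * t \<epsilon> x) * (\<epsilon> * t2 \<epsilon> x) / 2 - (\<epsilon> * t1 \<epsilon> x)\<^sup>2 / 4 - V x * (1 + \<epsilon> * t \<epsilon> x)\<^sup>2)
         + (1 + \<epsilon> * t \<epsilon> x)\<^sup>2 - 1 = \<epsilon> ^ Suc K * s \<epsilon> x"
    by blast
  obtain s1 where s1: "\<And>\<epsilon> x. \<epsilon> \<in> {0..1} \<Longrightarrow> (s \<epsilon> has_vector_derivative s1 \<epsilon> x) (at x)"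
    "uniformly_smooth {0..1} s1"
    using uniformly_smooth_has_derivative[OF us(4)] by blast
  obtain s2 where s2: "\<And>\<epsilon> x. \<epsilon> \<in> {0..1} \<Longrightarrow> (s1 \<epsilon> has_vector_derivative s2 \<epsilon> x) (at x)"
    "uniformly_smooth {0..1} s2"
    using uniformly_smooth_has_derivative[OF s1(2)] by blast
  have pw: "uniformly_smooth {0..1} (\<lambda>\<epsilon>::real. \<lambda>x. c * \<epsilon> ^ k)" for c :: real and k
  proof (rule uniformly_smooth_const)
    show "norm (c * e ^ k) \<le> \<bar>c\<bar>" if "e \<in> {0..1}" for e
      using that by (simp add: abs_mult mult_left_le power_le_one)
  qed
  \<comment> \<open>The new remainder apart from the terms of \<open>r\<^sup>2\<close>. Each scalar is written as a constant times a power of \<open>\<epsilon>\<close> so that one closure rule treats them all.\<close>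
  define B where "B \<epsilon> x = 1 * \<epsilon> ^ 0 * (V x * ((1 + 1 * \<epsilon> ^ 1 * t \<epsilon> x) * s \<epsilon> x))
     - (1/4) * \<epsilon> ^ 0 * ((1 + 1 * \<epsilon> ^ 1 * t \<epsilon> x) * s2 \<epsilon> x)
     - (1/4) * \<epsilon> ^ 1 * (s \<epsilon> x * t2 \<epsilon> x)
     + (1/4) * \<epsilon> ^ 1 * (t1 \<epsilon> x * s1 \<epsilon> x)
     + 1 * \<epsilon> ^ Suc K * ((1/8) * \<epsilon> ^ 0 * (s \<epsilon> x * s2 \<epsilon> x) - (1/16) * \<epsilon> ^ 0 * (s1 \<epsilon> x * s1 \<epsilon> x)
          - (1/4) * \<epsilon> ^ 0 * (V x * (s \<epsilon> x * s \<epsilon> x)))" for \<epsilon> x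
  have one: "uniformly_smooth {0..1} (\<lambda>\<epsilon>::real. \<lambda>x. c::real)" for c
    by (rule uniformly_smooth_const[of _ _ "\<bar>c\<bar>"]) simp
  have B: "uniformly_smooth {0..1} B"
    unfolding B_def
    by (intro uniformly_smooth_add uniformly_smooth_diff uniformly_smooth_mult pw one us s1 s2 assms)
  let ?t = "\<lambda>\<epsilon> x. t \<epsilon> x - (1/2) * \<epsilon> ^ K * s \<epsilon> x"
  let ?t1 = "\<lambda>\<epsilon> x. t1 \<epsilon> x - (1/2) * \<epsilon> ^ K * s1 \<epsilon> x"
  let ?t2 = "\<lambda>\<epsilon> x. t2 \<epsilon> x - (1/2) * \<epsilon> ^ K * s2 \<epsilon> x"
  let ?s = "\<lambda>\<epsilon> x. B \<epsilon> x - t \<epsilon> x * s \<epsilon> x + (1/4) * \<epsilon> ^ K * (s \<epsilon> x * s \<epsilon> x)"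
  have "\<epsilon> * ((1 + \<epsilon> * ?t \<epsilon> x) * (\<epsilon> * ?t2 \<epsilon> x) / 2 - (\<epsilon> * ?t1 \<epsilon> x)\<^sup>2 / 4 - V x * (1 + \<epsilon> * ?t \<epsilon> x)\<^sup>2)
         + (1 + \<epsilon> * ?t \<epsilon> x)\<^sup>2 - 1 = \<epsilon> ^ Suc (Suc K) * ?s \<epsilon> x" if e: "\<epsilon> \<in> {0..1}" for \<epsilon> x
  proof -
    have "\<epsilon> * ((1 + \<epsilon> * ?t \<epsilon> x) * (\<epsilon> * ?t2 \<epsilon> x) / 2 - (\<epsilon> * ?t1 \<epsilon> x)\<^sup>2 / 4 - V x * (1 + \<epsilon> * ?t \<epsilon> x)\<^sup>2)
         + (1 + \<epsilon> * ?t \<epsilon> x)\<^sup>2 - 1 - \<epsilon> ^ Suc (Suc K) * ?s \<epsilon> x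
       = (\<epsilon> * ((1 + \<epsilon> * t \<epsilon> x) * (\<epsilon> * t2 \<epsilon> x) / 2 - (\<epsilon> * t1 \<epsilon> x)\<^sup>2 / 4 - V x * (1 + \<epsilon> * t \<epsilon> x)\<^sup>2)
         + (1 + \<epsilon> * t \<epsilon> x)\<^sup>2 - 1) - \<epsilon> ^ Suc K * s \<epsilon> x"
      unfolding B_def by (simp add: power2_eq_square field_simps)
    then show ?thesis using eq[OF e, of x] by linarith
  qed
  moreover have "uniformly_smooth {0..1} ?t" "uniformly_smooth {0..1} ?t1"
    "uniformly_smooth {0..1} ?t2" "uniformly_smooth {0..1} ?s"
    by (intro uniformly_smooth_add uniformly_smooth_diff uniformly_smooth_mult pw us s1 s2 B)+
  moreover have "(?t \<epsilon> has_real_derivative ?t1 \<epsilon> x) (at x)"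
    "(?t1 \<epsilon> has_real_derivative ?t2 \<epsilon> x) (at x)" if e: "\<epsilon> \<in> {0..1}" for \<epsilon> x
    using d[OF e, of x] s1(1)[OF e, of x] s2(1)[OF e, of x]
    unfolding has_real_derivative_iff_has_vector_derivative[symmetric]
    by (auto intro!: derivative_eq_intros)
  ultimately show ?case by blast
qed

section \<open>Integrable functions with an integrable derivative\<close>

lemma not_integrable_bounded_below_at_top:
  fixes g :: "real \<Rightarrow> real"
  assumes g: "integrable lborel g" and nonneg: "\<And>x. g x \<ge> 0" and ge: "\<And>x. x \<ge> R \<Longrightarrow> g x \<ge> c"
  shows "c \<le> 0"
proof (rule ccontr)
  assume "\<not> c \<le> 0"
  then have c: "c > 0" by simp
  have "integrable lborel (\<lambda>x. c * indicator {R..} x :: real)"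
    using c nonneg ge by (intro Bochner_Integration.integrable_bound[OF g]) (auto simp: indicator_def)
  then have "integrable lborel (indicator {R..} :: real \<Rightarrow> real)"
    using c by simp
  then have "emeasure lborel {R..} < \<infinity>"
    by (simp add: integrable_indicator_iff)
  moreover have "emeasure lborel {R..} \<ge> ennreal (real n)" for n
  proof -
    have "emeasure lborel {R..} \<ge> emeasure lborel {R..R + real n}"
      by (intro emeasure_mono) auto
    then show ?thesis by simp
  qed
  ultimately show False
    by (metis ennreal_Ex_less_of_nat ennreal_of_nat_eq_real_of_nat infinity_ennreal_def leD)
qed

lemma integral_derivative_Icc:
  fixes f f' :: "real \<Rightarrow> real"
  assumes d: "\<And>x. (f has_real_derivative f' x) (at x)" and f': "integrable lborel f'" and "a \<le> b"
  shows "(LBINT x. indicator {a..b} x * f' x) = f b - f a"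
proof -
  have i: "set_integrable lborel {a..b} f'"
    unfolding set_integrable_def using f' by (intro integrable_mult_indicator) auto
  have "(f' has_integral (f b - f a)) {a..b}"
    using d \<open>a \<le> b\<close> by (intro fundamental_theorem_of_calculus)
      (auto simp: has_real_derivative_iff_has_vector_derivative intro: has_vector_derivative_at_within)
  then have "integral {a..b} f' = f b - f a" by (rule integral_unique)
  then show ?thesis
    using set_borel_integral_eq_integral(2)[OF i] by (simp add: set_lebesgue_integral_def)
qed

text \<open>Otherwise \<open>f\<close> would stay away from zero on all of \<open>{x..}\<close>, since it cannot vary by more than the
  integral of \<open>\<bar>f'\<bar>\<close>, and would not be integrable.\<close>

lemma abs_le_integral_abs_derivative:
  fixes f f' :: "real \<Rightarrow> real"
  assumes d: "\<And>x. (f has_real_derivative f' x) (at x)"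
    and f: "integrable lborel f" and f': "integrable lborel f'"
  shows "\<bar>f x\<bar> \<le> (LBINT x. \<bar>f' x\<bar>)"
proof -
  have *: "\<bar>f b - f a\<bar> \<le> (LBINT x. \<bar>f' x\<bar>)" if "a \<le> b" for a b
  proof -
    have "\<bar>LBINT x. indicator {a..b} x * f' x\<bar> \<le> (LBINT x. \<bar>indicator {a..b} x * f' x\<bar>)"
      by (rule integral_abs_bound)
    also have "\<dots> \<le> (LBINT x. \<bar>f' x\<bar>)"
      using f' by (intro integral_mono_AE' AE_I2) (auto simp: indicator_def)
    finally show ?thesis
      using integral_derivative_Icc[OF d f' that] by simp
  qed
  have "\<bar>f x\<bar> - (LBINT x. \<bar>f' x\<bar>) \<le> 0"
  proof (rule not_integrable_bounded_below_at_top)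
    show "integrable lborel (\<lambda>x. \<bar>f x\<bar>)" using f by simp
    show "\<bar>f y\<bar> \<ge> \<bar>f x\<bar> - (LBINT x. \<bar>f' x\<bar>)" if "y \<ge> x" for y
      using *[OF that] by linarith
  qed simp
  then show ?thesis by simp
qed

text \<open>The integral over \<open>{-T..T}\<close> is \<open>f T - f (-T)\<close>. Were its limit nonzero, \<open>\<bar>f T\<bar> + \<bar>f (-T)\<bar>\<close> would stay
  away from zero for large \<open>T\<close>, contradicting integrability.\<close>

lemma integral_derivative_eq_0:
  fixes f f' :: "real \<Rightarrow> real"
  assumes d: "\<And>x. (f has_real_derivative f' x) (at x)"
    and f: "integrable lborel f" and f': "integrable lborel f'"
  shows "(LBINT x. f' x) = 0"
proof -
  let ?J = "LBINT x. f' x"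
  have "((\<lambda>T. LBINT x. indicator {-T..T} x * f' x) \<longlongrightarrow> ?J) at_top"
  proof (rule integral_dominated_convergence_at_top[where w = "\<lambda>x. \<bar>f' x\<bar>"])
    show "AE x in lborel. ((\<lambda>T. indicator {-T..T} x * f' x) \<longlongrightarrow> f' x) at_top"
    proof (intro AE_I2 tendsto_eventually)
      fix x show "\<forall>\<^sub>F T in at_top. indicator {-T..T} x * f' x = f' x"
        using eventually_ge_at_top[of "\<bar>x\<bar>"] by eventually_elim (auto simp: indicator_def)
    qed
  qed (use f' in \<open>auto simp: indicator_def\<close>)
  then have "((\<lambda>T. \<bar>LBINT x. indicator {-T..T} x * f' x\<bar>) \<longlongrightarrow> \<bar>?J\<bar>) at_top"
    by (rule tendsto_rabs)
  show ?thesis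
  proof (rule ccontr)
    assume J: "?J \<noteq> 0"
    then have "\<forall>\<^sub>F T in at_top. \<bar>LBINT x. indicator {-T..T} x * f' x\<bar> > \<bar>?J\<bar> / 2"
      by (intro order_tendstoD(1)[OF \<open>((\<lambda>T. \<bar>_\<bar>) \<longlongrightarrow> _) at_top\<close>]) simp
    then obtain R where R: "\<And>T. T \<ge> R \<Longrightarrow> \<bar>LBINT x. indicator {-T..T} x * f' x\<bar> > \<bar>?J\<bar> / 2"
      by (auto simp: eventually_at_top_linorder)
    have "\<bar>?J\<bar> / 2 \<le> 0"
    proof (rule not_integrable_bounded_below_at_top)
      show "integrable lborel (\<lambda>x. \<bar>f x\<bar> + \<bar>f (- x)\<bar>)"
        using f lborel_integrable_real_affine[OF f, of "-1" 0] by auto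
      show "\<bar>?J\<bar> / 2 \<le> \<bar>f T\<bar> + \<bar>f (-T)\<bar>" if "T \<ge> max 0 R" for T
      proof -
        have "\<bar>f T - f (-T)\<bar> > \<bar>?J\<bar> / 2"
          using R[of T] integral_derivative_Icc[OF d f', of "-T" T] that by simp
        then show ?thesis by linarith
      qed
    qed simp
    with J show False by simp
  qed
qed

section \<open>Energy estimates for classical solutions\<close>

text \<open>The eigenvalue equation as a first-order system, with \<open>W\<close> the covariant derivative of \<open>U\<close> for the
  magnetic potential \<open>b\<close>.\<close>

locale covariant_solution =
  fixes U W :: "real \<Rightarrow> complex" and b V :: "real \<Rightarrow> real" and \<Lambda> :: real
  assumes U: "\<And>x. (U has_vector_derivative W x - \<i> * b x * U x) (at x)"
    and W: "\<And>x. (W has_vector_derivative (V x - \<Lambda>) * U x - \<i> * b x * W x) (at x)"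
    and U_L2: "integrable lborel (\<lambda>x. (norm (U x))\<^sup>2)"
    and W_L2: "integrable lborel (\<lambda>x. (norm (W x))\<^sup>2)"
begin

lemma continuous_U: "continuous_on UNIV U" and continuous_W: "continuous_on UNIV W"
  using has_vector_derivative_continuous[OF U] has_vector_derivative_continuous[OF W]
  by (auto simp: continuous_on_eq_continuous_at)

lemma measurable_U [measurable]: "U \<in> borel_measurable borel"
  and measurable_W [measurable]: "W \<in> borel_measurable borel"
  using continuous_U continuous_W by (auto intro: borel_measurable_continuous_onI)

text \<open>The potential \<open>b\<close> is absent from the result: it rotates \<open>U\<close> and \<open>W\<close> by the same phase.\<close>

lemma energy_derivative:
  assumes p: "(p has_real_derivative p') (at x)"
    and q: "(q has_real_derivative q') (at x)"
    and r: "(r has_real_derivative r') (at x)"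
  shows "((\<lambda>x. p x * (norm (U x))\<^sup>2 + 2 * q x * Re (cnj (U x) * W x) + r x * (norm (W x))\<^sup>2)
     has_real_derivative
       (p' + 2 * q x * (V x - \<Lambda>)) * (norm (U x))\<^sup>2
        + 2 * (p x + q' + r x * (V x - \<Lambda>)) * Re (cnj (U x) * W x)
        + (2 * q x + r') * (norm (W x))\<^sup>2) (at x)"
proof -
  define u1 u2 w1 w2 where "u1 x = Re (U x)" and "u2 x = Im (U x)"
    and "w1 x = Re (W x)" and "w2 x = Im (W x)" for x
  note defs = u1_def u2_def w1_def w2_def
  have du: "(u1 has_real_derivative w1 x + b x * u2 x) (at x)"
     "(u2 has_real_derivative w2 x - b x * u1 x) (at x)"
    using U[of x] unfolding has_vector_derivative_complex_iff by (simp_all add: defs[abs_def])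
  have dw: "(w1 has_real_derivative (V x - \<Lambda>) * u1 x + b x * w2 x) (at x)"
     "(w2 has_real_derivative (V x - \<Lambda>) * u2 x - b x * w1 x) (at x)"
    using W[of x] unfolding has_vector_derivative_complex_iff by (simp_all add: defs[abs_def])
  have eqs: "(norm (U x))\<^sup>2 = (u1 x)\<^sup>2 + (u2 x)\<^sup>2" "(norm (W x))\<^sup>2 = (w1 x)\<^sup>2 + (w2 x)\<^sup>2"
    "Re (cnj (U x) * W x) = u1 x * w1 x + u2 x * w2 x" for x
    by (simp_all add: defs cmod_power2)
  show ?thesis
    unfolding eqs
    by (rule derivative_eq_intros du dw p q r refl)+ (simp add: algebra_simps power2_eq_square)
qed

lemma cross_term_le: "\<bar>2 * Re (cnj (U x) * W x)\<bar> \<le> (norm (U x))\<^sup>2 + (norm (W x))\<^sup>2"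
proof -
  have "\<bar>Re (cnj (U x) * W x)\<bar> \<le> norm (U x) * norm (W x)"
    by (metis abs_Re_le_cmod complex_mod_cnj norm_mult)
  moreover have "2 * (norm (U x) * norm (W x)) \<le> (norm (U x))\<^sup>2 + (norm (W x))\<^sup>2"
    using sum_squares_bound[of "norm (U x)" "norm (W x)"] by simp
  ultimately show ?thesis by simp
qed

lemma integrable_cross: "integrable lborel (\<lambda>x. 2 * Re (cnj (U x) * W x))"
  by (rule Bochner_Integration.integrable_bound[OF Bochner_Integration.integrable_add[OF U_L2 W_L2]])
     (use cross_term_le in auto)

text \<open>Integrate the derivative of \<open>2 Re (cnj U W)\<close>, the choice \<open>p = 0\<close>, \<open>q = 1\<close>, \<open>r = 0\<close> of the
  quadratic form.\<close>

lemma energy_identity: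
  assumes V: "continuous_on UNIV V" "\<And>x. \<bar>V x\<bar> \<le> M"
  shows "(LBINT x. (norm (W x))\<^sup>2) \<le> (\<bar>\<Lambda>\<bar> + M) * (LBINT x. (norm (U x))\<^sup>2)"
proof -
  have [measurable]: "V \<in> borel_measurable borel"
    using V(1) by (rule borel_measurable_continuous_onI)
  have d: "((\<lambda>x. 2 * Re (cnj (U x) * W x)) has_real_derivative
      2 * ((V x - \<Lambda>) * (norm (U x))\<^sup>2 + (norm (W x))\<^sup>2)) (at x)" for x
    using energy_derivative[where p = "\<lambda>_. 0" and q = "\<lambda>_. 1" and r = "\<lambda>_. 0",
        OF DERIV_const DERIV_const DERIV_const, of x]
    by (simp add: algebra_simps)
  have VU: "integrable lborel (\<lambda>x. (\<Lambda> - V x) * (norm (U x))\<^sup>2)"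
  proof (rule Bochner_Integration.integrable_bound)
    show "integrable lborel (\<lambda>x. (\<bar>\<Lambda>\<bar> + M) * (norm (U x))\<^sup>2)" using U_L2 by simp
    have "\<bar>\<Lambda> - V x\<bar> \<le> \<bar>\<Lambda>\<bar> + M" for x using V(2)[of x] by linarith
    then show "AE x in lborel. norm ((\<Lambda> - V x) * (norm (U x))\<^sup>2) \<le> norm ((\<bar>\<Lambda>\<bar> + M) * (norm (U x))\<^sup>2)"
      by (intro AE_I2) (auto simp: abs_mult intro!: mult_right_mono order_trans[OF _ abs_ge_self])
  qed simp
  have eq: "2 * ((V x - \<Lambda>) * (norm (U x))\<^sup>2 + (norm (W x))\<^sup>2)
      = 2 * (norm (W x))\<^sup>2 - 2 * ((\<Lambda> - V x) * (norm (U x))\<^sup>2)" for x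
    by (simp add: algebra_simps)
  have "(LBINT x. 2 * ((V x - \<Lambda>) * (norm (U x))\<^sup>2 + (norm (W x))\<^sup>2)) = 0"
    using VU W_L2 unfolding eq
    by (intro integral_derivative_eq_0[OF d[unfolded eq] integrable_cross]) simp
  then have "(LBINT x. (norm (W x))\<^sup>2) = (LBINT x. (\<Lambda> - V x) * (norm (U x))\<^sup>2)"
    using VU W_L2 unfolding eq by simp
  also have "\<dots> \<le> (LBINT x. (\<bar>\<Lambda>\<bar> + M) * (norm (U x))\<^sup>2)"
  proof (rule integral_mono[OF VU])
    show "integrable lborel (\<lambda>x. (\<bar>\<Lambda>\<bar> + M) * (norm (U x))\<^sup>2)" using U_L2 by simp
    fix x
    have "\<Lambda> - V x \<le> \<bar>\<Lambda>\<bar> + M" using V(2)[of x] by linarith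
    then show "(\<Lambda> - V x) * (norm (U x))\<^sup>2 \<le> (\<bar>\<Lambda>\<bar> + M) * (norm (U x))\<^sup>2"
      by (intro mult_right_mono) auto
  qed
  finally show ?thesis by simp
qed

text \<open>The choice \<open>p = 1\<close>, \<open>q = 0\<close>, \<open>r = 0\<close>: this is the one-dimensional Sobolev inequality, with the
  covariant derivative controlled by the energy identity. The bound grows with \<open>\<Lambda>\<close> and is only useful
  for bounded energies.\<close>

lemma sup_bound_bounded_energy:
  assumes V: "continuous_on UNIV V" "\<And>x. \<bar>V x\<bar> \<le> M"
  shows "(norm (U x))\<^sup>2 \<le> (1 + \<bar>\<Lambda>\<bar> + M) * (LBINT x. (norm (U x))\<^sup>2)"
proof -
  have d: "((\<lambda>x. (norm (U x))\<^sup>2) has_real_derivative 2 * Re (cnj (U x) * W x)) (at x)" for x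
    using energy_derivative[where p = "\<lambda>_. 1" and q = "\<lambda>_. 0" and r = "\<lambda>_. 0",
        OF DERIV_const DERIV_const DERIV_const, of x]
    by simp
  have "(norm (U x))\<^sup>2 \<le> (LBINT x. \<bar>2 * Re (cnj (U x) * W x)\<bar>)"
    using abs_le_integral_abs_derivative[OF d U_L2 integrable_cross, of x] by simp
  also have "\<dots> \<le> (LBINT x. (norm (U x))\<^sup>2 + (norm (W x))\<^sup>2)"
    using integrable_cross U_L2 W_L2 cross_term_le by (intro integral_mono) auto
  also have "\<dots> \<le> (1 + \<bar>\<Lambda>\<bar> + M) * (LBINT x. (norm (U x))\<^sup>2)"
    using energy_identity[OF V] U_L2 W_L2 by (simp add: algebra_simps)
  finally show ?thesis .
qed

end

text \<open>The quadratic form \<open>E\<close> built from \<open>r = 1 + \<epsilon> t\<close> is almost conserved and, for \<open>\<Lambda>\<close> above a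
  threshold, dominates \<open>\<Lambda> |U|\<^sup>2 / 3\<close>. The threshold keeps \<open>r\<close> between \<open>1 / 2\<close> and \<open>3 / 2\<close> and the
  discriminant \<open>F\<close> above \<open>\<Lambda> / 2\<close>.\<close>

lemma sup_bound_large_energy:
  fixes V :: "real \<Rightarrow> real"
  assumes V: "uniformly_smooth {0..1} (\<lambda>_::real. V)"
  shows "\<exists>\<Lambda>\<^sub>0 C. \<Lambda>\<^sub>0 \<ge> 1 \<and> C > 0 \<and> (\<forall>\<Lambda> U W b. \<Lambda> \<ge> \<Lambda>\<^sub>0 \<longrightarrow> covariant_solution U W b V \<Lambda> \<longrightarrow>
     (\<forall>x. (norm (U x))\<^sup>2 \<le> C * (1 / \<Lambda>) ^ Suc K * (LBINT x. (norm (U x))\<^sup>2)))"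
proof -
  obtain t t1 t2 s where us: "uniformly_smooth {0..1} t" "uniformly_smooth {0..1} t1"
    "uniformly_smooth {0..1} t2" "uniformly_smooth {0..1::real} s"
    and d: "\<And>\<epsilon> x. \<epsilon> \<in> {0..1} \<Longrightarrow> (t \<epsilon> has_real_derivative t1 \<epsilon> x) (at x)"
      "\<And>\<epsilon> x. \<epsilon> \<in> {0..1} \<Longrightarrow> (t1 \<epsilon> has_real_derivative t2 \<epsilon> x) (at x)"
    and eq: "\<And>\<epsilon> x. \<epsilon> \<in> {0..1} \<Longrightarrow>
       \<epsilon> * ((1 + \<epsilon> * t \<epsilon> x) * (\<epsilon> * t2 \<epsilon> x) / 2 - (\<epsilon> * t1 \<epsilon> x)\<^sup>2 / 4 - V x * (1 + \<epsilon> * t \<epsilon> x)\<^sup>2)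
         + (1 + \<epsilon> * t \<epsilon> x)\<^sup>2 - 1 = \<epsilon> ^ Suc K * s \<epsilon> x"
    using adiabatic_expansion[OF V, of K] by blast
  obtain t3 where t3: "\<And>\<epsilon> x. \<epsilon> \<in> {0..1} \<Longrightarrow> (t2 \<epsilon> has_real_derivative t3 \<epsilon> x) (at x)"
    by (rule uniformly_smooth_has_real_derivative[OF us(3)]) blast
  obtain s1 where s1: "\<And>\<epsilon> x. \<epsilon> \<in> {0..1} \<Longrightarrow> (s \<epsilon> has_real_derivative s1 \<epsilon> x) (at x)"
    and us1: "uniformly_smooth {0..1} s1"
    by (rule uniformly_smooth_has_real_derivative[OF us(4)]) blast
  obtain s2 where s2: "\<And>\<epsilon> x. \<epsilon> \<in> {0..1} \<Longrightarrow> (s1 \<epsilon> has_real_derivative s2 \<epsilon> x) (at x)"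
    by (rule uniformly_smooth_has_real_derivative[OF us1]) blast
  obtain V1 where V1: "\<And>e x. e \<in> {0..1::real} \<Longrightarrow> (V has_real_derivative V1 e x) (at x)"
    by (rule uniformly_smooth_has_real_derivative[OF V]) blast
  define V' where "V' = V1 0"
  have V': "(V has_real_derivative V' x) (at x)" for x
    using V1[of 0] by (simp add: V'_def)
  obtain A where A: "\<And>e x. e \<in> {0..1} \<Longrightarrow> \<bar>t e x\<bar> \<le> A"
    by (rule uniformly_smooth_bounded[OF us(1)]) auto
  obtain A1 where A1: "\<And>e x. e \<in> {0..1} \<Longrightarrow> \<bar>t1 e x\<bar> \<le> A1"
    by (rule uniformly_smooth_bounded[OF us(2)]) auto
  obtain A2 where A2: "\<And>e x. e \<in> {0..1} \<Longrightarrow> \<bar>t2 e x\<bar> \<le> A2"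
    by (rule uniformly_smooth_bounded[OF us(3)]) auto
  obtain B where B: "\<And>e x. e \<in> {0..1} \<Longrightarrow> \<bar>s e x\<bar> \<le> B"
    by (rule uniformly_smooth_bounded[OF us(4)]) auto
  obtain B1 where B1: "B1 > 0" "\<And>e x. e \<in> {0..1} \<Longrightarrow> \<bar>s1 e x\<bar> \<le> B1"
    by (rule uniformly_smooth_bounded[OF us1]) auto
  obtain M where M: "\<And>x. \<bar>V x\<bar> \<le> M"
    using uniformly_smooth_bounded[OF V] by (metis atLeastAtMost_iff order_refl real_norm_def zero_le_one)
  \<comment> \<open>The lower bound \<open>1\<close> puts \<open>\<epsilon> = 1 / \<Lambda>\<close> in the parameter range \<open>{0..1}\<close> of the expansion.\<close>
  define \<Lambda>\<^sub>0 where "\<Lambda>\<^sub>0 = max 1 (max (2 * A) (2 * B))"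
  have "(norm (U x))\<^sup>2 \<le> 6 * B1 * (1 / \<Lambda>) ^ Suc K * (LBINT x. (norm (U x))\<^sup>2)"
    if \<Lambda>: "\<Lambda> \<ge> \<Lambda>\<^sub>0" and sol: "covariant_solution U W b V \<Lambda>" for \<Lambda> U W b x
  proof -
    interpret covariant_solution U W b V \<Lambda> by fact
    define \<epsilon> where "\<epsilon> = 1 / \<Lambda>"
    have \<Lambda>1: "\<Lambda> \<ge> 1" "\<Lambda> \<ge> 2 * A" "\<Lambda> \<ge> 2 * B" using \<Lambda> by (auto simp: \<Lambda>\<^sub>0_def)
    have e: "\<epsilon> \<in> {0..1}" "\<epsilon> > 0" "\<Lambda> * \<epsilon> = 1" using \<Lambda>1 by (auto simp: \<epsilon>_def)
    define r r1 r2 r3 where "r x = 1 + \<epsilon> * t \<epsilon> x" and "r1 x = \<epsilon> * t1 \<epsilon> x"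
      and "r2 x = \<epsilon> * t2 \<epsilon> x" and "r3 x = \<epsilon> * t3 \<epsilon> x" for x
    define p where "p x = r2 x / 2 - r x * (V x - \<Lambda>)" for x
    define E where "E x = p x * (norm (U x))\<^sup>2 + 2 * (- r1 x / 2) * Re (cnj (U x) * W x)
       + r x * (norm (W x))\<^sup>2" for x
    define G where "G x = \<epsilon> ^ K * s1 \<epsilon> x / r x" for x
    have r: "(r has_real_derivative r1 x) (at x)" "(r1 has_real_derivative r2 x) (at x)"
      "(r2 has_real_derivative r3 x) (at x)" for x
      unfolding r_def r1_def r2_def r3_def
      using d[OF e(1), of x] t3[OF e(1), of x] by (auto intro!: derivative_eq_intros)
    have r_bds: "1 / 2 \<le> r x" "r x \<le> 3 / 2" for x
    proof -
      have "\<epsilon> * \<bar>t \<epsilon> x\<bar> \<le> \<epsilon> * (\<Lambda> / 2)"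
        using A[OF e(1), of x] \<Lambda>1 e by (intro mult_left_mono) auto
      also have "\<dots> = 1 / 2" using e(3) by (simp add: mult.commute)
      finally have "\<bar>\<epsilon> * t \<epsilon> x\<bar> \<le> 1 / 2" using e by (simp add: abs_mult)
      then show "1 / 2 \<le> r x" "r x \<le> 3 / 2" unfolding r_def by linarith+
    qed
    \<comment> \<open>The expansion multiplied by \<open>\<Lambda>\<close>: the discriminant is \<open>\<Lambda>\<close> up to an error of order \<open>\<epsilon>\<^sup>K\<close>.\<close>
    have F: "r x * r2 x / 2 - (r1 x)\<^sup>2 / 4 - (r x)\<^sup>2 * (V x - \<Lambda>) = \<Lambda> + \<epsilon> ^ K * s \<epsilon> x" for x
    proof -
      have "\<Lambda> * (\<epsilon> * (r x * r2 x / 2 - (r1 x)\<^sup>2 / 4 - V x * (r x)\<^sup>2) + (r x)\<^sup>2 - 1)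
        = \<Lambda> * (\<epsilon> * (\<epsilon> ^ K * s \<epsilon> x))"
        using eq[OF e(1), of x] unfolding r_def r1_def r2_def by (simp add: mult.assoc)
      then have "(\<Lambda> * \<epsilon>) * (r x * r2 x / 2 - (r1 x)\<^sup>2 / 4 - V x * (r x)\<^sup>2) + \<Lambda> * (r x)\<^sup>2 - \<Lambda>
        = (\<Lambda> * \<epsilon>) * (\<epsilon> ^ K * s \<epsilon> x)"
        by (simp only: algebra_simps)
      then show ?thesis unfolding e(3) by (simp add: algebra_simps)
    qed
    have F_lower: "\<Lambda> / 2 \<le> \<Lambda> + \<epsilon> ^ K * s \<epsilon> x" for x
    proof -
      have "\<epsilon> ^ K * \<bar>s \<epsilon> x\<bar> \<le> 1 * (\<Lambda> / 2)"
        using e B[OF e(1), of x] \<Lambda>1 by (intro mult_mono power_le_one) auto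
      then have "\<bar>\<epsilon> ^ K * s \<epsilon> x\<bar> \<le> \<Lambda> / 2" using e by (simp add: abs_mult)
      then show ?thesis by linarith
    qed
    \<comment> \<open>Differentiating the discriminant identity; \<open>r G\<close> is the derivative of its left-hand side.\<close>
    have rG: "r3 x / 2 - 2 * r1 x * (V x - \<Lambda>) - r x * V' x = G x" for x
    proof -
      have "((\<lambda>x. r x * r2 x / 2 - (r1 x)\<^sup>2 / 4 - (r x)\<^sup>2 * (V x - \<Lambda>)) has_real_derivative
          r x * (r3 x / 2 - 2 * r1 x * (V x - \<Lambda>) - r x * V' x)) (at x)"
        using r[of x] V'[of x]
        by (auto intro!: derivative_eq_intros) (simp add: algebra_simps power2_eq_square)
      moreover have "((\<lambda>x. \<Lambda> + \<epsilon> ^ K * s \<epsilon> x) has_real_derivative \<epsilon> ^ K * s1 \<epsilon> x) (at x)"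
        using s1[OF e(1), of x] by (auto intro!: derivative_eq_intros)
      ultimately have "r x * (r3 x / 2 - 2 * r1 x * (V x - \<Lambda>) - r x * V' x) = \<epsilon> ^ K * s1 \<epsilon> x"
        unfolding F by (rule DERIV_unique)
      then show ?thesis using r_bds[of x] by (simp add: G_def field_simps)
    qed
    have dE: "(E has_real_derivative G x * (norm (U x))\<^sup>2) (at x)" for x
    proof -
      have p: "(p has_real_derivative (r3 x / 2 - (r1 x * (V x - \<Lambda>) + r x * V' x))) (at x)"
        unfolding p_def using r[of x] V'[of x] by (auto intro!: derivative_eq_intros)
      have q: "((\<lambda>x. - r1 x / 2) has_real_derivative - r2 x / 2) (at x)"
        using r[of x] by (auto intro!: derivative_eq_intros)
      have "(r3 x / 2 - (r1 x * (V x - \<Lambda>) + r x * V' x) + 2 * (- r1 x / 2) * (V x - \<Lambda>)) = G x"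
        unfolding rG[symmetric] by (simp add: algebra_simps)
      moreover have "p x + - r2 x / 2 + r x * (V x - \<Lambda>) = 0" by (simp add: p_def)
      ultimately show ?thesis
        using energy_derivative[OF p q r(1)] unfolding E_def by simp
    qed
    have E_int: "integrable lborel E"
    proof (rule Bochner_Integration.integrable_bound)
      let ?P = "A2 + 2 * (M + \<bar>\<Lambda>\<bar>) + A1 + 2"
      show "integrable lborel (\<lambda>x. ?P * ((norm (U x))\<^sup>2 + (norm (W x))\<^sup>2))"
        using U_L2 W_L2 by simp
      show "E \<in> borel_measurable lborel"
        using DERIV_continuous[OF dE]
        by (auto intro!: borel_measurable_continuous_onI simp: continuous_on_eq_continuous_at)
      show "AE x in lborel. norm (E x) \<le> norm (?P * ((norm (U x))\<^sup>2 + (norm (W x))\<^sup>2))"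
      proof (intro AE_I2)
        fix x
        let ?S = "(norm (U x))\<^sup>2 + (norm (W x))\<^sup>2"
        have le1: "\<epsilon> * \<bar>z\<bar> \<le> \<bar>z\<bar>" for z using e by (simp add: mult_left_le_one_le)
        have "\<bar>r x * (V x - \<Lambda>)\<bar> \<le> 2 * (M + \<bar>\<Lambda>\<bar>)"
          unfolding abs_mult using r_bds[of x] M[of x] by (intro mult_mono) auto
        moreover have "\<bar>r2 x\<bar> \<le> A2" "\<bar>r1 x\<bar> \<le> A1"
          using le1[of "t2 \<epsilon> x"] le1[of "t1 \<epsilon> x"] A2[OF e(1), of x] A1[OF e(1), of x] e
          by (auto simp: r2_def r1_def abs_mult)
        ultimately have "\<bar>p x\<bar> \<le> A2 + 2 * (M + \<bar>\<Lambda>\<bar>)" and r1: "\<bar>r1 x\<bar> \<le> A1"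
          unfolding p_def by linarith+
        then have "\<bar>p x * (norm (U x))\<^sup>2\<bar> \<le> (A2 + 2 * (M + \<bar>\<Lambda>\<bar>)) * ?S"
          unfolding abs_mult by (intro mult_mono) auto
        moreover have "\<bar>- r1 x / 2 * (2 * Re (cnj (U x) * W x))\<bar> \<le> A1 * ?S"
          unfolding abs_mult[of "- r1 x / 2"] using r1 cross_term_le by (intro mult_mono) auto
        moreover have "\<bar>r x * (norm (W x))\<^sup>2\<bar> \<le> 2 * ?S"
          unfolding abs_mult using r_bds[of x] by (intro mult_mono) auto
        moreover have "2 * (- r1 x / 2) * Re (cnj (U x) * W x) = - r1 x / 2 * (2 * Re (cnj (U x) * W x))"
          by (simp only: mult_ac)
        ultimately have "\<bar>E x\<bar> \<le> (A2 + 2 * (M + \<bar>\<Lambda>\<bar>)) * ?S + A1 * ?S + 2 * ?S"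
          unfolding E_def by linarith
        also have "\<dots> = ?P * ?S" by (simp add: algebra_simps)
        finally show "norm (E x) \<le> norm (?P * ?S)" by simp
      qed
    qed
    have G_bd: "\<bar>G x\<bar> \<le> 2 * B1 * \<epsilon> ^ K" for x
    proof -
      have "\<bar>G x\<bar> = \<epsilon> ^ K * \<bar>s1 \<epsilon> x\<bar> / r x"
        using e r_bds[of x] by (simp add: G_def abs_mult)
      also have "\<dots> \<le> \<epsilon> ^ K * B1 / (1 / 2)"
        using e r_bds[of x] B1(1) B1(2)[OF e(1), of x] by (intro frac_le mult_left_mono) auto
      finally show ?thesis by (simp add: mult_ac)
    qed
    have GU_le: "\<bar>G x * (norm (U x))\<^sup>2\<bar> \<le> 2 * B1 * \<epsilon> ^ K * (norm (U x))\<^sup>2" for x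
      unfolding abs_mult using G_bd[of x] by (auto intro!: mult_mono)
    have GU: "integrable lborel (\<lambda>x. G x * (norm (U x))\<^sup>2)"
    proof (rule Bochner_Integration.integrable_bound)
      show "integrable lborel (\<lambda>x. 2 * B1 * \<epsilon> ^ K * (norm (U x))\<^sup>2)" using U_L2 by simp
      have [measurable]: "r \<in> borel_measurable borel" "s1 \<epsilon> \<in> borel_measurable borel"
        using DERIV_continuous[OF r(1)] DERIV_continuous[OF s2[OF e(1)]]
        by (auto intro!: borel_measurable_continuous_onI simp: continuous_on_eq_continuous_at)
      show "(\<lambda>x. G x * (norm (U x))\<^sup>2) \<in> borel_measurable lborel"
        unfolding G_def by measurable
      show "AE x in lborel. norm (G x * (norm (U x))\<^sup>2) \<le> norm (2 * B1 * \<epsilon> ^ K * (norm (U x))\<^sup>2)"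
        using GU_le by (intro AE_I2) (auto intro: order_trans[OF _ abs_ge_self])
    qed
    have "(\<Lambda> / 3) * (norm (U x))\<^sup>2 \<le> E x"
    proof -
      \<comment> \<open>Completing the square.\<close>
      have "r x * E x = (\<Lambda> + \<epsilon> ^ K * s \<epsilon> x) * (norm (U x))\<^sup>2
          + (norm (r x * W x - (r1 x / 2) * U x))\<^sup>2"
        unfolding F[of x, symmetric] E_def p_def cmod_power2
        by (simp add: algebra_simps power2_eq_square)
      then have "(\<Lambda> / 2) * (norm (U x))\<^sup>2 \<le> r x * E x"
        using mult_right_mono[OF F_lower[of x] zero_le_power2[of "norm (U x)"]]
          zero_le_power2[of "norm (r x * W x - (r1 x / 2) * U x)"] by linarith
      moreover have "0 \<le> (\<Lambda> / 2) * (norm (U x))\<^sup>2" using \<Lambda>1 by simp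
      ultimately have "0 \<le> r x * E x" by linarith
      then have "0 \<le> E x" using r_bds(1)[of x] by (simp add: zero_le_mult_iff)
      then have "r x * E x \<le> (3 / 2) * E x" using r_bds(2)[of x] by (intro mult_right_mono)
      then show ?thesis using \<open>(\<Lambda> / 2) * _ \<le> r x * E x\<close> by simp
    qed
    also have "E x \<le> (LBINT x. \<bar>G x * (norm (U x))\<^sup>2\<bar>)"
      using abs_le_integral_abs_derivative[OF dE E_int GU, of x] by simp
    also have "\<dots> \<le> (LBINT x. 2 * B1 * \<epsilon> ^ K * (norm (U x))\<^sup>2)"
      using GU U_L2 GU_le by (intro integral_mono) auto
    also have "\<dots> = 2 * B1 * \<epsilon> ^ K * (LBINT x. (norm (U x))\<^sup>2)" by simp
    finally have "(3 * \<epsilon>) * ((\<Lambda> / 3) * (norm (U x))\<^sup>2) \<le> (3 * \<epsilon>) * (2 * B1 * \<epsilon> ^ K * (LBINT x. (norm (U x))\<^sup>2))"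
      using e by (intro mult_left_mono) auto
    moreover have "(3 * \<epsilon>) * ((\<Lambda> / 3) * (norm (U x))\<^sup>2) = (\<Lambda> * \<epsilon>) * (norm (U x))\<^sup>2" by simp
    ultimately have "(norm (U x))\<^sup>2 \<le> (3 * \<epsilon>) * (2 * B1 * \<epsilon> ^ K * (LBINT x. (norm (U x))\<^sup>2))"
      by (simp only: e(3) mult_1)
    then show ?thesis
      unfolding \<epsilon>_def[symmetric] by (simp add: mult_ac)
  qed
  then show ?thesis
    using B1(1) by (intro exI[of _ \<Lambda>\<^sub>0] exI[of _ "6 * B1"]) (auto simp: \<Lambda>\<^sub>0_def)
qed

lemma sup_bound_all_energies:
  fixes V :: "real \<Rightarrow> real"
  assumes V: "uniformly_smooth {0..1} (\<lambda>_::real. V)"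
  shows "\<exists>C>0. \<forall>\<Lambda> U W b. \<Lambda> > 1 \<longrightarrow> covariant_solution U W b V \<Lambda> \<longrightarrow>
     (\<forall>x. (norm (U x))\<^sup>2 \<le> C * (1 / \<Lambda>) ^ K * (LBINT x. (norm (U x))\<^sup>2))"
proof -
  obtain \<Lambda>\<^sub>0 C where C: "\<Lambda>\<^sub>0 \<ge> 1" "C > 0"
    "\<And>\<Lambda> U W b x. \<Lambda> \<ge> \<Lambda>\<^sub>0 \<Longrightarrow> covariant_solution U W b V \<Lambda> \<Longrightarrow>
       (norm (U x))\<^sup>2 \<le> C * (1 / \<Lambda>) ^ Suc K * (LBINT x. (norm (U x))\<^sup>2)"
    using sup_bound_large_energy[OF V, of K] by blast
  obtain M where M: "M > 0" "\<And>x. \<bar>V x\<bar> \<le> M"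
    using uniformly_smooth_bounded[OF V] by (metis atLeastAtMost_iff order_refl real_norm_def zero_le_one)
  have cont: "continuous_on UNIV V"
  proof -
    obtain V' where "\<And>e x. e \<in> {0..1::real} \<Longrightarrow> (V has_real_derivative V' e x) (at x)"
      by (rule uniformly_smooth_has_real_derivative[OF V]) blast
    from DERIV_continuous[OF this[of 0]] show ?thesis
      by (simp add: continuous_on_eq_continuous_at)
  qed
  let ?D = "(1 + \<Lambda>\<^sub>0 + M) * \<Lambda>\<^sub>0 ^ K"
  have "(norm (U x))\<^sup>2 \<le> (C + ?D) * (1 / \<Lambda>) ^ K * (LBINT x. (norm (U x))\<^sup>2)"
    if \<Lambda>: "\<Lambda> > 1" and sol: "covariant_solution U W b V \<Lambda>" for \<Lambda> U W b x
  proof -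
    interpret covariant_solution U W b V \<Lambda> by fact
    let ?I = "LBINT x. (norm (U x))\<^sup>2"
    have I: "?I \<ge> 0" by simp
    have D: "?D > 0" using C M by simp
    show ?thesis
    proof (cases "\<Lambda> \<ge> \<Lambda>\<^sub>0")
      case True
      have "(norm (U x))\<^sup>2 \<le> C * (1 / \<Lambda>) ^ Suc K * ?I" using C(3)[OF True sol] .
      also have "\<dots> \<le> (C + ?D) * (1 / \<Lambda>) ^ K * ?I"
        using \<Lambda> C D I by (intro mult_right_mono mult_mono power_decreasing) auto
      finally show ?thesis .
    next
      case False
      have "(norm (U x))\<^sup>2 \<le> (1 + \<bar>\<Lambda>\<bar> + M) * ?I"
        by (rule sup_bound_bounded_energy[OF cont M(2)])
      also have "1 + \<bar>\<Lambda>\<bar> + M \<le> ?D * (1 / \<Lambda>) ^ K"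
      proof -
        have "1 \<le> (\<Lambda>\<^sub>0 / \<Lambda>) ^ K" using False \<Lambda> by (intro one_le_power) simp
        then have "(1 + \<Lambda>\<^sub>0 + M) * 1 \<le> (1 + \<Lambda>\<^sub>0 + M) * (\<Lambda>\<^sub>0 / \<Lambda>) ^ K"
          using C M by (intro mult_left_mono) auto
        then show ?thesis using False \<Lambda> by (simp add: power_divide)
      qed
      also have "?D * (1 / \<Lambda>) ^ K \<le> (C + ?D) * (1 / \<Lambda>) ^ K"
        using \<Lambda> C by (intro mult_right_mono) auto
      finally show ?thesis using I by (simp add: mult_right_mono)
    qed
  qed
  moreover have "C + ?D > 0" using C M by (simp add: add_pos_pos)
  ultimately show ?thesis by blast
qed

section \<open>Bump functions\<close>

lemma power_mult_poly_mult_exp_tendsto_0: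
  "((\<lambda>y::real. y ^ k * poly P y * exp (- y)) \<longlongrightarrow> 0) at_top"
proof (induction P arbitrary: k)
  case 0
  then show ?case by simp
next
  case (pCons a P)
  have "((\<lambda>y::real. a * (y ^ k / exp y) + y ^ Suc k * poly P y * exp (- y)) \<longlongrightarrow> a * 0 + 0) at_top"
    by (intro tendsto_add tendsto_mult tendsto_const tendsto_power_div_exp_0 pCons.IH)
  moreover have "a * (y ^ k / exp y) + y ^ Suc k * poly P y * exp (- y)
      = y ^ k * poly (pCons a P) y * exp (- y)" for y :: real
    by (simp add: exp_minus field_simps)
  ultimately show ?case by simp
qed

text \<open>The functions \<open>P (1 / x) exp (- 1 / x)\<close>, continued by zero. The family contains the standard smooth
  step function (\<open>P = 1\<close>) and is closed under differentiation, so one induction gives smoothness and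
  the boundedness of all derivatives.\<close>

definition flat_poly :: "real poly \<Rightarrow> real \<Rightarrow> real" where
  "flat_poly P x = (if x \<le> 0 then 0 else poly P (1 / x) * exp (- (1 / x)))"

lemma flat_poly_tendsto_0: "((\<lambda>x. flat_poly P x / x) \<longlongrightarrow> 0) (at 0)"
proof (rule filterlim_split_at)
  show "((\<lambda>x. flat_poly P x / x) \<longlongrightarrow> 0) (at_left 0)"
  proof (rule tendsto_eventually)
    show "\<forall>\<^sub>F x in at_left 0. flat_poly P x / x = 0"
      unfolding eventually_at_filter by (rule always_eventually) (simp add: flat_poly_def)
  qed
  have "((\<lambda>x. (inverse x) ^ 1 * poly P (inverse x) * exp (- inverse x)) \<longlongrightarrow> 0) (at_right (0::real))"
    using filterlim_compose[OF power_mult_poly_mult_exp_tendsto_0[of 1 P] filterlim_inverse_at_top_right]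
    by simp
  moreover have "\<forall>\<^sub>F x in at_right 0. (inverse x) ^ 1 * poly P (inverse x) * exp (- inverse x) = flat_poly P x / x"
    unfolding eventually_at_filter
    by (rule always_eventually) (simp add: flat_poly_def inverse_eq_divide)
  ultimately show "((\<lambda>x. flat_poly P x / x) \<longlongrightarrow> 0) (at_right 0)"
    by (rule Lim_transform_eventually)
qed

lemma flat_poly_bounded: "\<exists>M. \<forall>x. \<bar>flat_poly P x\<bar> \<le> M"
proof -
  have "((\<lambda>y. poly P y * exp (- y)) \<longlongrightarrow> 0) at_top"
    using power_mult_poly_mult_exp_tendsto_0[of 0 P] by simp
  then have "\<forall>\<^sub>F y in at_top. dist (poly P y * exp (- y)) 0 < 1"
    by (rule tendstoD) simp
  then obtain Y where Y: "\<And>y. y \<ge> Y \<Longrightarrow> \<bar>poly P y * exp (- y)\<bar> < 1"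
    by (auto simp: eventually_at_top_linorder)
  have "compact ((\<lambda>y. poly P y * exp (- y)) ` {0..Y})"
    by (intro compact_continuous_image continuous_intros compact_Icc)
  then have "bounded ((\<lambda>y. poly P y * exp (- y)) ` {0..Y})"
    by (rule compact_imp_bounded)
  then obtain M where "\<forall>z\<in>(\<lambda>y. poly P y * exp (- y)) ` {0..Y}. norm z \<le> M"
    unfolding bounded_iff by blast
  then have M: "\<bar>poly P y * exp (- y)\<bar> \<le> M" if "y \<in> {0..Y}" for y
    using that by simp
  have bd: "\<bar>poly P y * exp (- y)\<bar> \<le> max 1 M" if "y \<ge> 0" for y
  proof (cases "y \<ge> Y")
    case True
    then show ?thesis using Y[of y] by linarith
  next
    case False
    then show ?thesis using M[of y] that by simp
  qed
  have "\<bar>flat_poly P x\<bar> \<le> max 1 M" for x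
    using bd[of "1 / x"] by (simp add: flat_poly_def le_max_iff_disj)
  then show ?thesis by blast
qed

lemma flat_poly_has_derivative:
  "(flat_poly P has_real_derivative flat_poly ([:0, 0, 1:] * (P - pderiv P)) x) (at x)"
proof -
  consider "x < 0" | "x = 0" | "x > 0" by linarith
  then show ?thesis
  proof cases
    case 1
    have "((\<lambda>_. 0) has_real_derivative 0) (at x)" by simp
    then have "(flat_poly P has_real_derivative 0) (at x)"
      by (rule has_field_derivative_transform_within_open[where S = "{..<0}"])
         (use 1 in \<open>auto simp: flat_poly_def\<close>)
    then show ?thesis using 1 by (simp add: flat_poly_def)
  next
    case 2
    then show ?thesis
      using flat_poly_tendsto_0[of P] by (simp add: has_field_derivative_iff flat_poly_def)
  next
    case 3
    have i: "((\<lambda>x. 1 / x) has_real_derivative - ((1 / x) * (1 / x))) (at x)"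
      using 3 by (auto intro!: derivative_eq_intros simp: field_simps)
    have "((\<lambda>x. poly P (1 / x) * exp (- (1 / x))) has_real_derivative
        poly (pderiv P) (1 / x) * - ((1 / x) * (1 / x)) * exp (- (1 / x))
        + exp (- (1 / x)) * - (- ((1 / x) * (1 / x))) * poly P (1 / x)) (at x)"
      by (intro DERIV_mult DERIV_chain2[OF poly_DERIV i] DERIV_fun_exp DERIV_minus i)
    moreover have "poly (pderiv P) (1 / x) * - ((1 / x) * (1 / x)) * exp (- (1 / x))
        + exp (- (1 / x)) * - (- ((1 / x) * (1 / x))) * poly P (1 / x)
        = flat_poly ([:0, 0, 1:] * (P - pderiv P)) x"
      using 3 by (simp add: flat_poly_def algebra_simps)
    ultimately have "((\<lambda>x. poly P (1 / x) * exp (- (1 / x))) has_real_derivative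
        flat_poly ([:0, 0, 1:] * (P - pderiv P)) x) (at x)"
      by simp
    then show ?thesis
      by (rule has_field_derivative_transform_within_open[where S = "{0<..}"])
         (use 3 in \<open>auto simp: flat_poly_def\<close>)
  qed
qed

lemma uniformly_smooth_flat_poly: "uniformly_smooth I (\<lambda>_. flat_poly P)"
proof -
  have "uniformly_Ck I n (\<lambda>_. flat_poly P)" for n
  proof (induction n arbitrary: P)
    case 0
    then show ?case using flat_poly_bounded by simp
  next
    case (Suc n)
    then show ?case
      using flat_poly_bounded[of P] flat_poly_has_derivative[of P]
      by (auto simp only: uniformly_Ck.simps real_norm_def has_real_derivative_iff_has_vector_derivative
          intro!: exI[of _ "\<lambda>_. flat_poly ([:0, 0, 1:] * (P - pderiv P))"])
  qed
  then show ?thesis by (simp add: uniformly_smooth_def)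
qed

lemma uniformly_smooth_affine:
  assumes "uniformly_smooth I f"
  shows "uniformly_smooth I (\<lambda>e x. f e (c * x + d))"
proof -
  have "uniformly_Ck I n f \<Longrightarrow> uniformly_Ck I n (\<lambda>e x. f e (c * x + d))" for n
  proof (induction n arbitrary: f)
    case 0
    then show ?case by auto
  next
    case (Suc n)
    obtain f' where f': "\<And>e x. e \<in> I \<Longrightarrow> (f e has_vector_derivative f' e x) (at x)" "uniformly_Ck I n f'"
      using Suc.prems unfolding uniformly_Ck.simps by blast
    have "((\<lambda>x. f e (c * x + d)) has_vector_derivative of_real c * f' e (c * x + d)) (at x)"
      if "e \<in> I" for e x
    proof -
      have "((\<lambda>x. c * x + d) has_real_derivative c) (at x)"
        by (auto intro!: derivative_eq_intros)
      then have "((\<lambda>x. c * x + d) has_vector_derivative c) (at x)"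
        by (simp only: has_real_derivative_iff_has_vector_derivative)
      from vector_diff_chain_at[OF this f'(1)[OF that]] show ?thesis
        by (simp add: o_def scaleR_conv_of_real)
    qed
    moreover have "uniformly_Ck I n (\<lambda>e x. of_real c * f' e (c * x + d))"
      using uniformly_smooth_const[of I "\<lambda>_. of_real c" "\<bar>c\<bar>"] Suc.IH[OF f'(2)]
      by (intro uniformly_Ck_mult) (auto simp: uniformly_smooth_def)
    moreover have "\<exists>M. \<forall>e\<in>I. \<forall>x. norm (f e (c * x + d)) \<le> M"
      using Suc.prems by auto
    ultimately show ?case
      unfolding uniformly_Ck.simps
      by (intro conjI exI[of _ "\<lambda>e x. of_real c * f' e (c * x + d)"]) auto
  qed
  then show ?thesis
    using assms by (simp add: uniformly_smooth_def)
qed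

text \<open>A smooth substitute for the indicator of the interval from \<open>a\<close> to \<open>b\<close>. Since the step function tends
  to \<open>1\<close> at infinity, letting \<open>n\<close> grow makes the bump converge to the indicator, without normalisation.\<close>

definition bump :: "real \<Rightarrow> real \<Rightarrow> real \<Rightarrow> real \<Rightarrow> complex" where
  "bump n a b x = of_real (flat_poly 1 (n * (x - a)) * flat_poly 1 (n * (b - x)))"

lemma uniformly_smooth_bump: "uniformly_smooth I (\<lambda>_. bump n a b)"
proof -
  have "uniformly_smooth I (\<lambda>_ x. flat_poly 1 (c * x + d))" for c d
    by (rule uniformly_smooth_affine[OF uniformly_smooth_flat_poly])
  from uniformly_smooth_bounded_linear[OF bounded_linear_of_real uniformly_smooth_mult[OF this this]]
  have "uniformly_smooth I (\<lambda>_ x. of_real (flat_poly 1 (n * x + - n * a) * flat_poly 1 (- n * x + n * b)) :: complex)" .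
  moreover have "bump n a b = (\<lambda>x. of_real (flat_poly 1 (n * x + - n * a) * flat_poly 1 (- n * x + n * b)))"
    by (intro ext) (simp add: bump_def algebra_simps)
  ultimately show ?thesis by simp
qed

lemma test_functionI:
  assumes "smooth f" "\<And>x. x \<notin> {a..b} \<Longrightarrow> f x = 0"
  shows "test_function f"
proof -
  have "closure {x. f x \<noteq> 0} \<subseteq> {a..b}"
    using assms(2) by (intro closure_minimal closed_atLeastAtMost) blast
  then have "compact (closure {x. f x \<noteq> 0})"
    by (meson bounded_closed_interval bounded_subset closed_closure compact_eq_bounded_closed)
  with assms(1) show ?thesis by (simp add: test_function_def)
qed

lemma bump_outside: "n > 0 \<Longrightarrow> x \<notin> {a<..<b} \<Longrightarrow> bump n a b x = 0"
  by (auto simp: bump_def flat_poly_def mult_le_0_iff not_less)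

lemma bump_inside: "n > 0 \<Longrightarrow> x \<in> {a<..<b} \<Longrightarrow>
  bump n a b x = of_real (exp (- (1 / (n * (x - a)))) * exp (- (1 / (n * (b - x)))))"
  by (auto simp: bump_def flat_poly_def mult_le_0_iff)

lemma norm_bump_le_1: "norm (bump n a b x) \<le> 1"
proof -
  have "\<bar>flat_poly 1 y\<bar> \<le> 1" for y by (simp add: flat_poly_def)
  then have "\<bar>flat_poly 1 (n * (x - a))\<bar> * \<bar>flat_poly 1 (n * (b - x))\<bar> \<le> 1 * 1"
    by (intro mult_mono) auto
  then show ?thesis by (simp add: bump_def norm_mult)
qed

lemma smooth_bump: "smooth (bump n a b)"
  by (rule uniformly_smooth_imp_smooth[OF uniformly_smooth_bump])

lemma test_function_bump: "n > 0 \<Longrightarrow> test_function (bump n a b)"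
  by (rule test_functionI[OF smooth_bump, of a b]) (auto intro: bump_outside)

lemma bump_tendsto_indicator:
  "(\<lambda>n. bump (real (Suc n)) a b x) \<longlonglongrightarrow> indicator {a<..<b} x"
proof (cases "x \<in> {a<..<b}")
  case True
  have lim: "(\<lambda>n. exp (- (1 / (real (Suc n) * c)))) \<longlonglongrightarrow> 1" if "c > 0" for c :: real
  proof -
    have "(\<lambda>n. exp (- (inverse (real (Suc n)) * inverse c))) \<longlonglongrightarrow> exp (- (0 * inverse c))"
      by (intro tendsto_intros LIMSEQ_inverse_real_of_nat)
    then show ?thesis by (simp add: field_simps)
  qed
  have "(\<lambda>n. complex_of_real (exp (- (1 / (real (Suc n) * (x - a)))) * exp (- (1 / (real (Suc n) * (b - x))))))
      \<longlonglongrightarrow> of_real (1 * 1)"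
    using True by (intro tendsto_of_real tendsto_mult lim) auto
  then show ?thesis
    using True by (simp add: bump_inside del: of_nat_Suc)
next
  case False
  then show ?thesis by (simp add: bump_outside del: of_nat_Suc)
qed

section \<open>The fundamental lemma of the calculus of variations\<close>

lemma sigma_finite_lebesgue: "sigma_finite_measure (lebesgue :: real measure)"
proof
  show "\<exists>A::real set set. countable A \<and> A \<subseteq> sets lebesgue \<and> \<Union>A = space lebesgue \<and> (\<forall>a\<in>A. emeasure lebesgue a \<noteq> \<infinity>)"
  proof (intro exI conjI ballI)
    show "countable (range (\<lambda>n::nat. {- real n..real n}))" by simp
    have "\<exists>n::nat. x \<in> {- real n..real n}" for x
      using real_arch_simple[of "\<bar>x\<bar>"] by (metis abs_le_D1 abs_le_D2 atLeastAtMost_iff minus_le_iff)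
    then show "\<Union> (range (\<lambda>n::nat. {- real n..real n})) = space lebesgue"
      by fastforce
  qed auto
qed

lemma bump_measurable [measurable]: "bump n a b \<in> borel_measurable borel"
  by (rule borel_measurable_continuous_onI[OF smooth_imp_continuous[OF smooth_bump]])

lemma borel_imp_lebesgue_measurable: "f \<in> borel_measurable borel \<Longrightarrow> f \<in> borel_measurable lebesgue"
  by (intro measurable_completion) simp

lemma locally_integrable_Icc:
  "locally_integrable f \<Longrightarrow> integrable lebesgue (\<lambda>x. indicator {a..b} x *\<^sub>R f x)"
  by (simp add: locally_integrable_def set_integrable_def)

lemma locally_integrable_subset:
  assumes "locally_integrable f" "S \<in> sets lebesgue" "S \<subseteq> {a..b}"
  shows "integrable lebesgue (\<lambda>x. indicator S x *\<^sub>R f x)"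
proof -
  have "integrable lebesgue (\<lambda>x. indicator S x *\<^sub>R (indicator {a..b} x *\<^sub>R f x))"
    by (intro integrable_mult_indicator locally_integrable_Icc assms)
  moreover have "indicator S x *\<^sub>R (indicator {a..b} x *\<^sub>R f x) = indicator S x *\<^sub>R f x" for x
    using assms(3) by (auto simp: indicator_def)
  ultimately show ?thesis by (simp only:)
qed

lemma integral_mult_bump_tendsto:
  assumes f: "locally_integrable f"
  shows "(\<lambda>n. LINT x|lebesgue. f x * bump (real (Suc n)) a b x)
     \<longlonglongrightarrow> (LINT x|lebesgue. indicator {a<..<b} x *\<^sub>R f x)"
proof (rule integral_dominated_convergence[where w = "\<lambda>x. norm (indicator {a..b} x *\<^sub>R f x)"])
  note [measurable] = borel_imp_lebesgue_measurable[OF bump_measurable]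
  have [measurable]: "(\<lambda>x. indicator {a..b} x *\<^sub>R f x) \<in> borel_measurable lebesgue"
    by (rule borel_measurable_integrable[OF locally_integrable_Icc[OF f]])
  have "f x * bump (real (Suc n)) a b x = (indicator {a..b} x *\<^sub>R f x) * bump (real (Suc n)) a b x" for n x
    by (auto simp: indicator_def bump_outside simp del: of_nat_Suc)
  moreover have "(\<lambda>x. (indicator {a..b} x *\<^sub>R f x) * bump (real (Suc n)) a b x) \<in> borel_measurable lebesgue" for n
    by measurable
  ultimately show "(\<lambda>x. f x * bump (real (Suc n)) a b x) \<in> borel_measurable lebesgue" for n
    by (simp only:)
  show "(\<lambda>x. indicator {a<..<b} x *\<^sub>R f x) \<in> borel_measurable lebesgue"
    by (rule borel_measurable_integrable[OF locally_integrable_subset[OF f, of _ a b]]) auto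
  show "integrable lebesgue (\<lambda>x. norm (indicator {a..b} x *\<^sub>R f x))"
    using locally_integrable_Icc[OF f] by (rule integrable_norm)
  show "AE x in lebesgue. (\<lambda>n. f x * bump (real (Suc n)) a b x) \<longlonglongrightarrow> indicator {a<..<b} x *\<^sub>R f x"
  proof (intro AE_I2)
    fix x
    have "(\<lambda>n. f x * bump (real (Suc n)) a b x) \<longlonglongrightarrow> f x * indicator {a<..<b} x"
      by (intro tendsto_mult tendsto_const bump_tendsto_indicator)
    then show "(\<lambda>n. f x * bump (real (Suc n)) a b x) \<longlonglongrightarrow> indicator {a<..<b} x *\<^sub>R f x"
      by (auto simp: indicator_def split: if_splits)
  qed
  show "AE x in lebesgue. norm (f x * bump (real (Suc n)) a b x) \<le> norm (indicator {a..b} x *\<^sub>R f x)" for n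
    using norm_bump_le_1[of "real (Suc n)" a b]
    by (intro AE_I2) (auto simp: indicator_def norm_mult bump_outside intro: mult_left_le simp del: of_nat_Suc)
qed

text \<open>In the limit the bumps give that \<open>f\<close> has integral zero over every interval. Intervals generate the
  Borel sets, so the integrals over all Borel sets vanish, and the completion adds only null sets.\<close>

lemma AE_zero_if_bump_integrals_zero:
  assumes f: "locally_integrable f"
    and zero: "\<And>n a b. n > 0 \<Longrightarrow> (LINT x|lebesgue. f x * bump n a b x) = 0"
  shows "AE x in lebesgue. f x = 0"
proof -
  have Ioo: "(LINT x|lebesgue. indicator {a<..<b} x *\<^sub>R f x) = 0" for a b
    using integral_mult_bump_tendsto[OF f, of a b] zero
    by (simp add: LIMSEQ_const_iff del: of_nat_Suc)
  have Ioc: "(LINT x|lebesgue. indicator {a<..b} x *\<^sub>R f x) = 0" for a b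
  proof -
    have "(LINT x|lebesgue. indicator {a<..b} x *\<^sub>R f x) = (LINT x|lebesgue. indicator {a<..<b} x *\<^sub>R f x)"
    proof (rule integral_cong_AE)
      show "AE x in lebesgue. indicator {a<..b} x *\<^sub>R f x = indicator {a<..<b} x *\<^sub>R f x"
        using AE_completion[OF AE_lborel_singleton[of b]] by eventually_elim (auto simp: indicator_def)
    qed (auto intro!: borel_measurable_integrable[OF locally_integrable_subset[OF f, of _ a b]])
    then show ?thesis using Ioo by simp
  qed
  have loc: "AE x in lebesgue. indicator {-R<..R} x *\<^sub>R f x = 0" for R :: real
  proof (rule sigma_finite_measure.density_zero[OF sigma_finite_lebesgue])
    let ?f = "\<lambda>x. indicator {-R<..R} x *\<^sub>R f x"
    show int: "integrable lebesgue ?f"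
      by (rule locally_integrable_subset[OF f, of _ "-R" R]) auto
    have sint: "set_integrable lebesgue A ?f" if "A \<in> sets lebesgue" for A
      unfolding set_integrable_def using that int by (rule integrable_mult_indicator)
    have borel: "set_lebesgue_integral lebesgue A ?f = 0" if "A \<in> sets borel" for A
    proof -
      have "A \<in> sigma_sets UNIV (range (\<lambda>(a, b). {a <.. b::real}))"
        using that by (subst (asm) borel_sigma_sets_Ioc) simp
      have stable: "Int_stable (range (\<lambda>(a, b). {a <.. b::real}))"
        by (auto simp: Int_stable_def)
      have sub: "range (\<lambda>(a, b). {a <.. b::real}) \<subseteq> Pow UNIV" by simp
      show ?thesis
      proof (rule sigma_sets_induct_disjoint[OF stable sub \<open>A \<in> sigma_sets _ _\<close>])
        fix A assume "A \<in> range (\<lambda>(a, b). {a <.. b::real})"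
        then obtain a b where A: "A = {a<..b}" by auto
        have "indicator A x *\<^sub>R ?f x = indicator {max a (-R)<..min b R} x *\<^sub>R f x" for x
          by (auto simp: A indicator_def)
        then show "set_lebesgue_integral lebesgue A ?f = 0"
          using Ioc by (simp only: set_lebesgue_integral_def)
      next
        show "set_lebesgue_integral lebesgue {} ?f = 0"
          by (simp add: set_lebesgue_integral_def)
      next
        fix A assume A: "A \<in> sigma_sets UNIV (range (\<lambda>(a, b). {a <.. b::real}))"
          and 0: "set_lebesgue_integral lebesgue A ?f = 0"
        from A have "A \<in> sets borel" by (subst borel_sigma_sets_Ioc) simp
        then have A': "A \<in> sets lebesgue" by simp
        have "set_lebesgue_integral lebesgue (UNIV - A) ?f + set_lebesgue_integral lebesgue A ?f
           = set_lebesgue_integral lebesgue ((UNIV - A) \<union> A) ?f"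
          using A' by (intro set_integral_Un[symmetric] sint) auto
        also have "(UNIV - A) \<union> A = UNIV" by auto
        also have "set_lebesgue_integral lebesgue UNIV ?f = 0"
          using Ioc by (simp add: set_lebesgue_integral_def)
        finally show "set_lebesgue_integral lebesgue (UNIV - A) ?f = 0" using 0 by simp
      next
        fix A :: "nat \<Rightarrow> real set"
        assume disj: "disjoint_family A"
          and sig: "range A \<subseteq> sigma_sets UNIV (range (\<lambda>(a, b). {a <.. b::real}))"
          and 0: "\<And>i. set_lebesgue_integral lebesgue (A i) ?f = 0"
        have A: "A i \<in> sets lebesgue" for i
        proof -
          have "A i \<in> sets borel"
            using sig by (subst borel_sigma_sets_Ioc) auto
          then show ?thesis by simp
        qed
        have "set_lebesgue_integral lebesgue (\<Union>i. A i) ?f = (\<Sum>i. set_lebesgue_integral lebesgue (A i) ?f)"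
          using A disj by (intro lebesgue_integral_countable_add sint) (auto simp: disjoint_family_on_def)
        then show "set_lebesgue_integral lebesgue (\<Union>i. A i) ?f = 0" using 0 by simp
      qed
    qed
    show "set_lebesgue_integral lebesgue A ?f = 0" if "A \<in> sets lebesgue" for A
    proof -
      obtain S N N' where A: "A = S \<union> N" "N \<subseteq> N'" "N' \<in> null_sets lborel" "S \<in> sets lborel"
        using \<open>A \<in> sets lebesgue\<close> by (rule sets_completionE)
      have S: "S \<in> sets lebesgue" using A(4) by simp
      have "set_lebesgue_integral lebesgue A ?f = set_lebesgue_integral lebesgue S ?f"
        unfolding set_lebesgue_integral_def
      proof (rule integral_cong_AE)
        have "AE x in lebesgue. x \<notin> N'"
          using A(3) by (intro AE_completion AE_not_in)
        then show "AE x in lebesgue. indicator A x *\<^sub>R ?f x = indicator S x *\<^sub>R ?f x"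
          by eventually_elim (use A in \<open>auto simp: indicator_def\<close>)
      qed (use sint[OF that] sint[OF S] in \<open>auto simp: set_integrable_def\<close>)
      then show ?thesis using borel A(4) by simp
    qed
  qed
  have "AE x in lebesgue. \<forall>n::nat. indicator {- real n<..real n} x *\<^sub>R f x = 0"
    using loc by (simp only: AE_all_countable) blast
  then show ?thesis
  proof eventually_elim
    case (elim x)
    obtain n :: nat where "\<bar>x\<bar> < real n" using reals_Archimedean2 by blast
    then have "x \<in> {- real n<..real n}" by auto
    with elim[rule_format, of n] show ?case by simp
  qed
qed

lemma test_function_C1:
  assumes "test_function \<phi>"
  shows "(\<phi> has_vector_derivative vector_derivative \<phi> (at x)) (at x)"
    and "continuous_on UNIV \<phi>"
    and "continuous_on UNIV (\<lambda>x. vector_derivative \<phi> (at x))"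
proof -
  have sm: "smooth \<phi>"
    using assms by (simp add: test_function_def)
  have "\<phi> differentiable at x" for x
    using sm nth_deriv_0 unfolding smooth_def by metis
  then have d: "(\<phi> has_vector_derivative vector_derivative \<phi> (at x)) (at x)" for x
    by (simp add: vector_derivative_works)
  then show "(\<phi> has_vector_derivative vector_derivative \<phi> (at x)) (at x)" .
  show "continuous_on UNIV \<phi>"
    by (rule smooth_imp_continuous[OF sm])
  have "smooth (\<lambda>x. vector_derivative \<phi> (at x))"
    using sm unfolding smooth_def nth_deriv_Suc[symmetric] by blast
  then show "continuous_on UNIV (\<lambda>x. vector_derivative \<phi> (at x))"
    by (rule smooth_imp_continuous)
qed

lemma test_function_support:
  assumes "test_function \<phi>"
  shows "\<exists>R>0. (\<forall>x. x \<notin> {-R<..<R} \<longrightarrow> \<phi> x = 0) \<and>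
    (\<forall>x. x \<notin> {-R..R} \<longrightarrow> vector_derivative \<phi> (at x) = 0)"
proof -
  have "bounded (closure {x. \<phi> x \<noteq> 0})"
    using assms by (auto simp: test_function_def compact_imp_bounded)
  then have "bounded {x. \<phi> x \<noteq> 0}"
    using bounded_subset closure_subset by blast
  then obtain R where R: "R > 0" "\<forall>x\<in>{x. \<phi> x \<noteq> 0}. norm x < R"
    using bounded_pos_less by blast
  have zero: "\<phi> x = 0" if "x \<notin> {-R<..<R}" for x
    using R(2) that by (auto simp: abs_less_iff)
  have zero': "vector_derivative \<phi> (at x) = 0" if "x \<notin> {-R..R}" for x
  proof -
    have "((\<lambda>_. 0) has_vector_derivative 0) (at x)" by simp
    then have "(\<phi> has_vector_derivative 0) (at x)"
      by (rule has_vector_derivative_transform_within_open[where S = "- {-R..R}"])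
         (use that zero in \<open>auto intro!: open_Compl\<close>)
    then show ?thesis by (rule vector_derivative_at)
  qed
  show ?thesis
    by (intro exI[of _ R] conjI allI impI R(1) zero zero')
qed

lemma compactly_supported_integral:
  fixes g :: "real \<Rightarrow> complex"
  assumes "continuous_on UNIV g" "\<And>x. x \<notin> {a..b} \<Longrightarrow> g x = 0"
  shows "integrable lebesgue g" "(LINT x|lebesgue. g x) = integral {a..b} g"
    "integrable lborel g" "(LBINT x. g x) = integral {a..b} g"
proof -
  have "continuous_on {a..b} g" using assms(1) continuous_on_subset by blast
  then have i: "set_integrable lebesgue {a..b} g"
    by (rule absolutely_integrable_continuous_real)
  have eq: "indicator {a..b} x *\<^sub>R g x = g x" for x
    using assms(2)[of x] by (auto simp: indicator_def)
  show l: "integrable lebesgue g" using i by (simp only: set_integrable_def eq)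
  show il: "(LINT x|lebesgue. g x) = integral {a..b} g"
    using set_lebesgue_integral_eq_integral(2)[OF i] by (simp only: set_lebesgue_integral_def eq)
  have m: "g \<in> borel_measurable lborel"
    using borel_measurable_continuous_onI[OF assms(1)] by simp
  show "integrable lborel g" using l integrable_completion[OF m] by simp
  show "(LBINT x. g x) = integral {a..b} g" using il integral_completion[OF m] by simp
qed

lemma locally_integrable_mult_continuous:
  fixes g :: "real \<Rightarrow> complex"
  assumes f: "locally_integrable f" and g: "continuous_on UNIV g" and zero: "\<And>x. x \<notin> {a..b} \<Longrightarrow> g x = 0"
  shows "integrable lebesgue (\<lambda>x. f x * g x)"
proof -
  have "bounded (g ` {a..b})"
    by (intro compact_imp_bounded compact_continuous_image continuous_on_subset[OF g]) auto
  then obtain M where "\<forall>z\<in>g ` {a..b}. norm z \<le> M"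
    unfolding bounded_iff by blast
  then have M: "norm (g x) \<le> M" if "x \<in> {a..b}" for x
    using that by blast
  let ?f = "\<lambda>x. indicator {a..b} x *\<^sub>R f x"
  have f': "integrable lebesgue ?f" by (rule locally_integrable_Icc[OF f])
  note [measurable] = borel_measurable_integrable[OF f']
    borel_imp_lebesgue_measurable[OF borel_measurable_continuous_onI[OF g]]
  have eq: "f x * g x = ?f x * g x" for x
    using zero[of x] by (auto simp: indicator_def)
  have "integrable lebesgue (\<lambda>x. ?f x * g x)"
  proof (rule Bochner_Integration.integrable_bound)
    show "integrable lebesgue (\<lambda>x. M *\<^sub>R ?f x)" by (rule integrable_scaleR_right[OF f'])
    show "(\<lambda>x. ?f x * g x) \<in> borel_measurable lebesgue" by measurable
    show "AE x in lebesgue. norm (?f x * g x) \<le> norm (M *\<^sub>R ?f x)"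
    proof (intro AE_I2)
      fix x
      show "norm (?f x * g x) \<le> norm (M *\<^sub>R ?f x)"
      proof (cases "x \<in> {a..b}")
        case True
        then have "norm (g x) \<le> \<bar>M\<bar>" using M[of x] by linarith
        then have "norm (f x) * norm (g x) \<le> norm (f x) * \<bar>M\<bar>" by (intro mult_left_mono) auto
        then show ?thesis using True by (simp add: norm_mult mult.commute)
      qed simp
    qed
  qed
  then show ?thesis by (simp only: eq[symmetric])
qed

lemma continuous_imp_locally_integrable:
  assumes "continuous_on UNIV f"
  shows "locally_integrable f"
proof -
  have "set_integrable lebesgue K f" if "compact K" for K
  proof -
    have "set_integrable lborel K f"
      unfolding set_integrable_def
      using that assms by (intro borel_integrable_compact continuous_on_subset[OF assms]) auto
    moreover have "(\<lambda>x. indicator K x *\<^sub>R f x) \<in> borel_measurable lborel"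
      using borel_measurable_continuous_onI[OF assms] that
      by (auto intro!: borel_measurable_scaleR borel_measurable_indicator simp: compact_imp_closed)
    ultimately show ?thesis
      by (simp add: set_integrable_def integrable_completion)
  qed
  then show ?thesis by (simp add: locally_integrable_def)
qed

lemma locally_integrable_diff:
  "locally_integrable f \<Longrightarrow> locally_integrable g \<Longrightarrow> locally_integrable (\<lambda>x. f x - g x)"
  by (simp add: locally_integrable_def set_integral_diff)

text \<open>The antiderivative that vanishes to the left of \<open>a\<close> also vanishes to the right of \<open>b\<close>, because
  \<open>g\<close> has mean zero.\<close>

lemma test_function_primitive:
  assumes g: "smooth g" and zero: "\<And>x. x \<notin> {a..b} \<Longrightarrow> g x = 0" and "a \<le> b"
    and int: "(LINT x|lebesgue. g x) = 0"
  obtains \<psi> where "test_function \<psi>" "\<And>x. (\<psi> has_vector_derivative g x) (at x)"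
proof -
  have cont: "continuous_on UNIV g" by (rule smooth_imp_continuous[OF g])
  then have "\<exists>F. \<forall>x::real. -\<infinity> < ereal x \<longrightarrow> ereal x < \<infinity> \<longrightarrow> (F has_vector_derivative g x) (at x)"
    by (intro einterval_antiderivative) (auto simp: continuous_on_eq_continuous_at)
  then obtain F where F: "\<And>x. (F has_vector_derivative g x) (at x)" by auto
  have FTC: "(g has_integral F d - F c) {c..d}" if "c \<le> d" for c d
    using F that by (intro fundamental_theorem_of_calculus) (auto intro: has_vector_derivative_at_within)
  have "integral {a..b} g = 0"
    using compactly_supported_integral(2)[OF cont, of a b] zero int by auto
  then have ab: "F b = F a"
    using FTC[OF \<open>a \<le> b\<close>] by (simp add: integral_unique)
  have left: "F x = F a" if "x < a" for x
  proof -
    have "(g has_integral 0) {x..a}"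
    proof (rule has_integral_spike_finite[where S = "{a}"])
      show "((\<lambda>_. 0) has_integral 0) {x..a}" by simp
    qed (use zero in auto)
    from has_integral_unique[OF FTC this] that show ?thesis by simp
  qed
  have right: "F x = F a" if "x > b" for x
  proof -
    have "(g has_integral 0) {b..x}"
    proof (rule has_integral_spike_finite[where S = "{b}"])
      show "((\<lambda>_. 0) has_integral 0) {b..x}" by simp
    qed (use zero in auto)
    from has_integral_unique[OF FTC this] that ab show ?thesis by simp
  qed
  have d: "((\<lambda>x. F x - F a) has_vector_derivative g x) (at x)" for x
    using F by (auto intro!: derivative_eq_intros)
  have "test_function (\<lambda>x. F x - F a)"
    by (rule test_functionI[OF smooth_from_derivative[OF d g], of a b]) (use left right in force)
  then show ?thesis using d by (rule that)
qed

lemma not_AE_False_lebesgue: "\<not> (AE x::real in lebesgue. False)"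
proof
  assume "AE x::real in lebesgue. False"
  then have "emeasure lebesgue (UNIV :: real set) = 0"
    using AE_iff_measurable[of UNIV "lebesgue :: real measure" "\<lambda>_. False"] by auto
  then show False by simp
qed

text \<open>Subtracting from a bump the multiple of a fixed bump \<open>\<theta>\<close> with the same integral gives a derivative of
  a test function. Hence \<open>f\<close> integrates every bump as the constant \<open>c = (\<integral> f \<theta>) / (\<integral> \<theta>)\<close> does.\<close>

lemma constant_if_weak_deriv_zero:
  assumes f: "locally_integrable f"
    and zero: "\<And>\<phi>. test_function \<phi> \<Longrightarrow> (LINT x|lebesgue. f x * vector_derivative \<phi> (at x)) = 0"
  shows "\<exists>c. AE x in lebesgue. f x = c"
proof -
  have "\<exists>n a b. n > 0 \<and> (LINT x|lebesgue. bump n a b x) \<noteq> 0"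
  proof (rule ccontr)
    assume "\<not> ?thesis"
    then have "AE x::real in lebesgue. (1 :: complex) = 0"
      using AE_zero_if_bump_integrals_zero[OF continuous_imp_locally_integrable[OF continuous_on_const], of 1]
      by auto
    then show False using not_AE_False_lebesgue by simp
  qed
  then obtain n0 a0 b0 where n0: "n0 > 0" and m: "(LINT x|lebesgue. bump n0 a0 b0 x) \<noteq> 0" by blast
  let ?\<theta> = "bump n0 a0 b0" let ?m = "LINT x|lebesgue. bump n0 a0 b0 x"
  define c where "c = (LINT x|lebesgue. f x * ?\<theta> x) / ?m"
  have supp: "bump n a b x = 0" if "n > 0" "x \<notin> {a..b}" for n a b x
    using that by (intro bump_outside) auto
  have int_b: "integrable lebesgue (bump n a b)" if "n > 0" for n a b
    by (rule compactly_supported_integral(1)[OF smooth_imp_continuous[OF smooth_bump] supp[OF that]])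
  have int_fb: "integrable lebesgue (\<lambda>x. f x * bump n a b x)" if "n > 0" for n a b
    by (rule locally_integrable_mult_continuous[OF f smooth_imp_continuous[OF smooth_bump] supp[OF that]])
  have "AE x in lebesgue. f x - c = 0"
  proof (rule AE_zero_if_bump_integrals_zero)
    show "locally_integrable (\<lambda>x. f x - c)"
      by (intro locally_integrable_diff f continuous_imp_locally_integrable continuous_intros)
    fix n a b :: real assume n: "n > 0"
    let ?k = "LINT x|lebesgue. bump n a b x"
    let ?g = "\<lambda>x. bump n a b x - (?k / ?m) * ?\<theta> x"
    have "smooth ?g"
      by (rule uniformly_smooth_imp_smooth, intro uniformly_smooth_diff uniformly_smooth_mult
          uniformly_smooth_bump uniformly_smooth_const[OF order_refl])
    moreover have "?g x = 0" if "x \<notin> {min a a0..max (max b b0) (min a a0)}" for x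
    proof -
      have "x \<notin> {a..b}" "x \<notin> {a0..b0}" using that by auto
      then show ?thesis using supp n n0 by simp
    qed
    moreover have "min a a0 \<le> max (max b b0) (min a a0)" by simp
    moreover have "(LINT x|lebesgue. ?g x) = 0"
      using int_b[OF n] int_b[OF n0] m by simp
    ultimately obtain \<psi> where \<psi>: "test_function \<psi>" "\<And>x. (\<psi> has_vector_derivative ?g x) (at x)"
      using test_function_primitive[of ?g] by blast
    have "(LINT x|lebesgue. f x * ?g x) = 0"
      using zero[OF \<psi>(1)] vector_derivative_at[OF \<psi>(2)] by simp
    moreover have "f x * ?g x = f x * bump n a b x - (?k / ?m) * (f x * ?\<theta> x)" for x
      by (simp add: algebra_simps)
    ultimately have "(LINT x|lebesgue. f x * bump n a b x) = c * ?k"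
      using int_fb[OF n] int_fb[OF n0] by (simp add: c_def)
    then show "(LINT x|lebesgue. (f x - c) * bump n a b x) = 0"
      using int_fb[OF n, of a b] int_b[OF n, of a b] by (simp add: left_diff_distrib)
  qed
  then show ?thesis by auto
qed

section \<open>Weak derivatives and primitives\<close>

text \<open>The signed integral from \<open>0\<close> to \<open>x\<close>: an interval with reversed endpoints is empty, so one of the two
  terms is always zero.\<close>

definition primitive :: "(real \<Rightarrow> complex) \<Rightarrow> real \<Rightarrow> complex" where
  "primitive v x = integral {0..x} v - integral {x..0} v"

lemma locally_integrable_integrable_on: "locally_integrable v \<Longrightarrow> v integrable_on {a..b}"
  by (auto simp: locally_integrable_def intro: set_lebesgue_integral_eq_integral(1))

lemma primitive_eq:
  assumes v: "locally_integrable v" and "a \<le> 0" "a \<le> x"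
  shows "primitive v x = integral {a..x} v - integral {a..0} v"
proof (cases "0 \<le> x")
  case True
  have "integral {a..0} v + integral {0..x} v = integral {a..x} v"
    using True assms by (intro Henstock_Kurzweil_Integration.integral_combine locally_integrable_integrable_on)
  moreover have "integral {x..0} v = 0"
    using True by (cases "x = 0") auto
  ultimately show ?thesis by (simp add: primitive_def algebra_simps)
next
  case False
  have "integral {a..x} v + integral {x..0} v = integral {a..0} v"
    using False assms by (intro Henstock_Kurzweil_Integration.integral_combine locally_integrable_integrable_on) auto
  then show ?thesis using False by (simp add: primitive_def algebra_simps)
qed

lemma continuous_primitive:
  assumes v: "locally_integrable v"
  shows "continuous_on UNIV (primitive v)"
proof -
  have "isCont (primitive v) x" for x
  proof -
    define R where "R = \<bar>x\<bar> + 1"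
    have "continuous_on {-R..R} (\<lambda>x. integral {-R..x} v - integral {-R..0} v)"
      by (intro continuous_intros indefinite_integral_continuous_1 locally_integrable_integrable_on v)
    then have "continuous_on {-R..R} (primitive v)"
      by (rule continuous_on_eq) (use primitive_eq[OF v, of "-R"] in \<open>auto simp: R_def\<close>)
    moreover have "x \<in> interior {-R..R}" by (auto simp: R_def)
    ultimately show ?thesis by (rule continuous_on_interior)
  qed
  then show ?thesis by (simp add: continuous_on_eq_continuous_at)
qed

lemma primitive_has_derivative:
  assumes v: "continuous_on UNIV v"
  shows "(primitive v has_vector_derivative v x) (at x)"
proof -
  define R where "R = \<bar>x\<bar> + 1"
  have x: "x \<in> {-R<..<R}" by (auto simp: R_def)
  have "((\<lambda>x. integral {-R..x} v) has_vector_derivative v x) (at x within {-R..R})"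
    using x by (intro integral_has_vector_derivative continuous_on_subset[OF v]) auto
  then have "((\<lambda>x. integral {-R..x} v) has_vector_derivative v x) (at x)"
    using x at_within_interior[of x "{-R..R}"] by simp
  then have "((\<lambda>x. integral {-R..x} v - integral {-R..0} v) has_vector_derivative v x) (at x)"
    by (auto intro!: derivative_eq_intros)
  then show ?thesis
    by (rule has_vector_derivative_transform_within_open[where S = "{-R<..<R}"])
       (use x primitive_eq[OF continuous_imp_locally_integrable[OF v], of "-R"] in \<open>auto simp: R_def\<close>)
qed

lemma primitive_cong_AE:
  assumes "AE x in lebesgue. v x = w x"
  shows "primitive v = primitive w"
proof -
  have "{x. v x \<noteq> w x} \<in> null_sets lebesgue"
    using assms by (simp add: AE_iff_null_sets completion.AE_iff_null_sets)
  then have "negligible {x. v x \<noteq> w x}" by (simp add: negligible_iff_null_sets)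
  then have "integral S v = integral S w" for S
    by (intro integral_spike[of "{x. v x \<noteq> w x}"]) auto
  then show ?thesis by (auto simp: primitive_def)
qed

text \<open>Integration by parts for a primitive that is only absolutely continuous: exchange the two
  integrations over the triangle \<open>t \<le> x\<close> and apply the fundamental theorem of calculus to \<open>\<phi>\<close>. Borel
  measurability is needed for the product measure. The integral starts at the left end of
  the support instead of \<open>0\<close>; the difference is a constant.\<close>

lemma primitive_weak_deriv_borel:
  fixes w :: "real \<Rightarrow> complex"
  assumes w: "w \<in> borel_measurable borel" "locally_integrable w"
    and d: "\<And>x. (\<phi> has_vector_derivative \<phi>' x) (at x)"
    and cont: "continuous_on UNIV \<phi>'"
    and supp: "R > 0" "\<And>x. x \<notin> {-R<..<R} \<Longrightarrow> \<phi> x = 0" "\<And>x. x \<notin> {-R..R} \<Longrightarrow> \<phi>' x = 0"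
  shows "(LINT x|lebesgue. integral {-R..x} w * \<phi>' x) = - (LINT x|lebesgue. w x * \<phi> x)"
proof -
  have FTC: "(\<phi>' has_integral \<phi> b - \<phi> a) {a..b}" if "a \<le> b" for a b
    using d that by (intro fundamental_theorem_of_calculus) (auto intro: has_vector_derivative_at_within)
  note [measurable] = w(1) borel_measurable_continuous_onI[OF cont]
  have cont\<phi>: "continuous_on UNIV \<phi>"
    using has_vector_derivative_continuous[OF d] by (simp add: continuous_on_eq_continuous_at)
  note [measurable] = borel_measurable_continuous_onI[OF cont\<phi>]
  let ?w = "\<lambda>t. indicator {-R..R} t *\<^sub>R w t"
  have int_w: "integrable lborel ?w"
    using locally_integrable_Icc[OF w(2)] by (subst (asm) integrable_completion) auto
  have int_\<phi>': "integrable lborel \<phi>'"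
    by (rule compactly_supported_integral(3)[OF cont supp(3)])
  let ?F = "\<lambda>t x. indicator {t..} x *\<^sub>R (?w t * \<phi>' x)"
  have prod: "integrable (lborel \<Otimes>\<^sub>M lborel) (\<lambda>(t, x). ?w t * \<phi>' x)"
  proof (rule lborel_pair.Fubini_integrable)
    show "integrable lborel (\<lambda>t. LBINT x. norm (case (t, x) of (t, x) \<Rightarrow> ?w t * \<phi>' x))"
      unfolding prod.case norm_mult integral_mult_right_zero
      by (intro integrable_mult_left integrable_norm int_w)
    show "AE t in lborel. integrable lborel (\<lambda>x. case (t, x) of (t, x) \<Rightarrow> ?w t * \<phi>' x)"
      using int_\<phi>' by simp
  qed measurable
  have F: "integrable (lborel \<Otimes>\<^sub>M lborel) (case_prod ?F)"
  proof (rule Bochner_Integration.integrable_bound[OF prod])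
    have "(\<lambda>(t, x). (if t \<le> x then 1 else 0 :: real) *\<^sub>R (?w t * \<phi>' x)) \<in> borel_measurable (lborel \<Otimes>\<^sub>M lborel)"
      by measurable
    also have "(\<lambda>(t, x). (if t \<le> x then 1 else 0 :: real) *\<^sub>R (?w t * \<phi>' x)) = case_prod ?F"
      by (auto simp: fun_eq_iff indicator_def)
    finally show "case_prod ?F \<in> borel_measurable (lborel \<Otimes>\<^sub>M lborel)" .
    show "AE p in lborel \<Otimes>\<^sub>M lborel. norm (case_prod ?F p) \<le> norm (case p of (t, x) \<Rightarrow> ?w t * \<phi>' x)"
      by (intro AE_I2) (auto simp: indicator_def split: prod.splits)
  qed
  have inner_x: "(LBINT x. ?F t x) = - (w t * \<phi> t)" for t
  proof (cases "t \<in> {-R..R}")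
    case True
    have i: "set_integrable lborel {t..R} \<phi>'"
      unfolding set_integrable_def using int_\<phi>' by (intro integrable_mult_indicator) auto
    have "?F t x = w t * (indicator {t..R} x *\<^sub>R \<phi>' x)" for x
      using True supp(3)[of x] by (auto simp: indicator_def)
    then have "(LBINT x. ?F t x) = w t * (LBINT x. indicator {t..R} x *\<^sub>R \<phi>' x)"
      by (simp only: integral_mult_right_zero)
    also have "(LBINT x. indicator {t..R} x *\<^sub>R \<phi>' x) = \<phi> R - \<phi> t"
      using set_borel_integral_eq_integral(2)[OF i] FTC[of t R] True
      by (simp add: set_lebesgue_integral_def integral_unique)
    also have "\<phi> R = 0" using supp(2)[of R] by simp
    finally show ?thesis by simp
  next
    case False
    then show ?thesis using supp(2)[of t] by (auto simp: indicator_def)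
  qed
  have inner_t: "(LBINT t. ?F t x) = integral {-R..x} w * \<phi>' x" for x
  proof (cases "x \<in> {-R..R}")
    case True
    have "integrable lborel (\<lambda>t. indicator {-R..x} t *\<^sub>R ?w t)"
      by (rule integrable_mult_indicator[OF _ int_w]) simp
    moreover have "indicator {-R..x} t *\<^sub>R ?w t = indicator {-R..x} t *\<^sub>R w t" for t
      using True by (auto simp: indicator_def)
    ultimately have i: "set_integrable lborel {-R..x} w"
      by (simp only: set_integrable_def)
    have "?F t x = (indicator {-R..x} t *\<^sub>R w t) * \<phi>' x" for t
      using True by (auto simp: indicator_def)
    then have "(LBINT t. ?F t x) = (LBINT t. indicator {-R..x} t *\<^sub>R w t) * \<phi>' x"
      by (simp only: integral_mult_left_zero)
    then show ?thesis
      using set_borel_integral_eq_integral(2)[OF i] by (simp add: set_lebesgue_integral_def)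
  next
    case False
    then show ?thesis using supp(3)[of x] by simp
  qed
  have cont_I: "integral {-R..x} w * \<phi>' x = (primitive w x + integral {-R..0} w) * \<phi>' x" for x
    using primitive_eq[OF w(2), of "-R" x] supp(1) supp(3)[of x] by (cases "x \<in> {-R..R}") auto
  have "(LINT x|lebesgue. integral {-R..x} w * \<phi>' x) = (LBINT x. integral {-R..x} w * \<phi>' x)"
  proof (rule integral_completion)
    have "continuous_on UNIV (\<lambda>x. (primitive w x + integral {-R..0} w) * \<phi>' x)"
      by (intro continuous_intros continuous_primitive w(2) cont)
    then show "(\<lambda>x. integral {-R..x} w * \<phi>' x) \<in> borel_measurable lborel"
      unfolding cont_I using borel_measurable_continuous_onI by simp
  qed
  also have "\<dots> = (LBINT x. LBINT t. ?F t x)" by (simp only: inner_t)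
  also have "\<dots> = (LBINT t. LBINT x. ?F t x)" by (rule lborel_pair.Fubini_integral[OF F])
  also have "\<dots> = - (LBINT t. w t * \<phi> t)" by (simp only: inner_x integral_minus)
  also have "(LBINT t. w t * \<phi> t) = (LINT x|lebesgue. w x * \<phi> x)"
    by (rule integral_completion[symmetric]) measurable
  finally show ?thesis .
qed

lemma lebesgue_measurable_complex_borel_version:
  fixes v :: "real \<Rightarrow> complex"
  assumes [measurable]: "v \<in> borel_measurable lebesgue"
  obtains w where "w \<in> borel_measurable borel" "AE x in lebesgue. v x = w x"
proof -
  obtain p where p: "p \<in> borel_measurable lborel" "AE x in lborel. Re (v x) = p x"
    using completion_ex_borel_measurable_real[of "\<lambda>x. Re (v x)" lborel] by auto
  obtain q where q: "q \<in> borel_measurable lborel" "AE x in lborel. Im (v x) = q x"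
    using completion_ex_borel_measurable_real[of "\<lambda>x. Im (v x)" lborel] by auto
  show ?thesis
  proof (rule that[of "\<lambda>x. Complex (p x) (q x)"])
    show "(\<lambda>x. Complex (p x) (q x)) \<in> borel_measurable borel"
      using p(1) q(1) by (simp add: borel_measurable_complex_iff)
    show "AE x in lebesgue. v x = Complex (p x) (q x)"
      using AE_completion[OF p(2)] AE_completion[OF q(2)] by eventually_elim (simp add: complex_eq_iff)
  qed
qed

lemma locally_integrable_measurable:
  assumes "locally_integrable v"
  shows "v \<in> borel_measurable lebesgue"
proof (rule borel_measurable_LIMSEQ_metric)
  show "(\<lambda>x. indicator {- real n..real n} x *\<^sub>R v x) \<in> borel_measurable lebesgue" for n
    by (rule borel_measurable_integrable[OF locally_integrable_Icc[OF assms]])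
  fix x :: real
  have "\<forall>\<^sub>F n in sequentially. indicator {- real n..real n} x *\<^sub>R v x = v x"
    using eventually_ge_at_top[of "nat \<lceil>\<bar>x\<bar>\<rceil>"]
    by eventually_elim (auto simp: indicator_def nat_le_iff ceiling_le_iff abs_le_iff)
  then show "(\<lambda>n. indicator {- real n..real n} x *\<^sub>R v x) \<longlonglongrightarrow> v x"
    by (rule tendsto_eventually)
qed

lemma locally_integrable_cong_AE:
  assumes "locally_integrable v" "AE x in lebesgue. v x = w x" "w \<in> borel_measurable lebesgue"
  shows "locally_integrable w"
proof -
  have "set_integrable lebesgue K w" if K: "compact K" for K
  proof -
    have [measurable]: "K \<in> sets lebesgue" using K by (simp add: lmeasurable_compact fmeasurableD)
    have v: "integrable lebesgue (\<lambda>x. indicator K x *\<^sub>R v x)"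
      using assms(1) K by (simp add: locally_integrable_def set_integrable_def)
    have "integrable lebesgue (\<lambda>x. indicator K x *\<^sub>R w x)"
      by (rule integrable_cong_AE_imp[OF v])
         (use assms(2,3) in \<open>auto elim!: eventually_mono\<close>)
    then show ?thesis by (simp add: set_integrable_def)
  qed
  then show ?thesis by (simp add: locally_integrable_def)
qed

lemma primitive_has_weak_deriv:
  assumes v: "locally_integrable v"
  shows "has_weak_deriv (\<lambda>x. c + primitive v x) v"
  unfolding has_weak_deriv_def
proof (intro conjI allI impI v)
  show "locally_integrable (\<lambda>x. c + primitive v x)"
    by (intro continuous_imp_locally_integrable continuous_intros continuous_primitive v)
  fix \<phi> assume "test_function \<phi>"
  then obtain R where "R > 0 \<and> (\<forall>x. x \<notin> {-R<..<R} \<longrightarrow> \<phi> x = 0) \<and>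
      (\<forall>x. x \<notin> {-R..R} \<longrightarrow> vector_derivative \<phi> (at x) = 0)"
    by (blast dest: test_function_support)
  then have supp: "R > 0" "\<And>x. x \<notin> {-R<..<R} \<Longrightarrow> \<phi> x = 0"
      "\<And>x. x \<notin> {-R..R} \<Longrightarrow> vector_derivative \<phi> (at x) = 0"
    by simp_all
  let ?\<phi>' = "\<lambda>x. vector_derivative \<phi> (at x)"
  note d = test_function_C1(1)[OF \<open>test_function \<phi>\<close>] and cont\<phi> = test_function_C1(2)[OF \<open>test_function \<phi>\<close>]
    and cont = test_function_C1(3)[OF \<open>test_function \<phi>\<close>]
  obtain w where w: "w \<in> borel_measurable borel" "AE x in lebesgue. v x = w x"
    using lebesgue_measurable_complex_borel_version[OF locally_integrable_measurable[OF v]] .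
  have lw: "locally_integrable w"
    by (rule locally_integrable_cong_AE[OF v w(2) borel_imp_lebesgue_measurable[OF w(1)]])
  have supp0: "\<phi> x = 0" if "x \<notin> {-R..R}" for x using supp(2)[of x] that by auto
  have int: "integrable lebesgue (\<lambda>x. f x * \<phi> x)" if "locally_integrable f" for f
    by (rule locally_integrable_mult_continuous[OF that cont\<phi> supp0])
  have "(?\<phi>' has_integral \<phi> R - \<phi> (-R)) {-R..R}"
    using d supp(1) by (intro fundamental_theorem_of_calculus) (auto intro: has_vector_derivative_at_within)
  then have int0: "(LINT x|lebesgue. ?\<phi>' x) = 0"
    using compactly_supported_integral(2)[OF cont supp(3)] supp(2)[of R] supp(2)[of "-R"]
    by (simp add: integral_unique)
  have int\<phi>': "integrable lebesgue ?\<phi>'" by (rule compactly_supported_integral(1)[OF cont supp(3)])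
  have eq: "(c + primitive v x) * ?\<phi>' x = integral {-R..x} w * ?\<phi>' x + (c - integral {-R..0} w) * ?\<phi>' x" for x
  proof (cases "x \<in> {-R..R}")
    case True
    then have "integral {-R..x} w = primitive w x + integral {-R..0} w"
      using primitive_eq[OF lw, of "-R" x] supp(1) by simp
    then show ?thesis by (simp add: algebra_simps primitive_cong_AE[OF w(2)])
  qed (simp add: supp(3))
  have "integrable lebesgue (\<lambda>x. (c + primitive v x) * ?\<phi>' x)"
    by (intro locally_integrable_mult_continuous[OF _ cont supp(3)] continuous_imp_locally_integrable
        continuous_intros continuous_primitive v)
  then have "integrable lebesgue (\<lambda>x. ((c + primitive v x) * ?\<phi>' x) - (c - integral {-R..0} w) * ?\<phi>' x)"
    using int\<phi>' by (intro Bochner_Integration.integrable_diff integrable_mult_right) auto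
  then have "integrable lebesgue (\<lambda>x. integral {-R..x} w * ?\<phi>' x)"
    unfolding eq by simp
  then have "(LINT x|lebesgue. (c + primitive v x) * ?\<phi>' x) = (LINT x|lebesgue. integral {-R..x} w * ?\<phi>' x)"
    unfolding eq using int\<phi>' int0 by simp
  also have "\<dots> = - (LINT x|lebesgue. w x * \<phi> x)"
    by (rule primitive_weak_deriv_borel[OF w(1) lw d cont supp])
  also have "(LINT x|lebesgue. w x * \<phi> x) = (LINT x|lebesgue. v x * \<phi> x)"
  proof (rule integral_cong_AE)
    show "AE x in lebesgue. w x * \<phi> x = v x * \<phi> x"
      using w(2) by eventually_elim simp
  qed (use int[OF v] int[OF lw] in \<open>auto dest: borel_measurable_integrable\<close>)
  finally show "(LINT x|lebesgue. (c + primitive v x) * vector_derivative \<phi> (at x)) = - (LINT x|lebesgue. v x * \<phi> x)" .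
qed

text \<open>The difference of \<open>u\<close> and the primitive of \<open>v\<close> has weak derivative zero.\<close>

lemma has_weak_deriv_imp_primitive:
  assumes uv: "has_weak_deriv u v"
  shows "\<exists>c. AE x in lebesgue. u x = c + primitive v x"
proof -
  have u: "locally_integrable u" and v: "locally_integrable v"
    using uv by (auto simp: has_weak_deriv_def)
  have p: "has_weak_deriv (primitive v) v" using primitive_has_weak_deriv[OF v, of 0] by simp
  have lp: "locally_integrable (primitive v)" using p by (simp add: has_weak_deriv_def)
  have "\<exists>c. AE x in lebesgue. u x - primitive v x = c"
  proof (rule constant_if_weak_deriv_zero[OF locally_integrable_diff[OF u lp]])
    fix \<phi> assume \<phi>: "test_function \<phi>"
    obtain R where "\<forall>x. x \<notin> {-R..R} \<longrightarrow> vector_derivative \<phi> (at x) = 0"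
      using test_function_support[OF \<phi>] by blast
    then have supp: "\<And>x. x \<notin> {-R..R} \<Longrightarrow> vector_derivative \<phi> (at x) = 0"
      by simp
    let ?\<phi>' = "\<lambda>x. vector_derivative \<phi> (at x)"
    note cont = test_function_C1(3)[OF \<phi>]
    have "(LINT x|lebesgue. u x * ?\<phi>' x) = (LINT x|lebesgue. primitive v x * ?\<phi>' x)"
      using uv p \<phi> by (simp add: has_weak_deriv_def)
    moreover have "integrable lebesgue (\<lambda>x. f x * ?\<phi>' x)" if "locally_integrable f" for f
      by (rule locally_integrable_mult_continuous[OF that cont supp])
    note this[OF u] this[OF lp]
    ultimately have "(LINT x|lebesgue. (u x - primitive v x) * ?\<phi>' x) = 0"
      by (simp add: left_diff_distrib)
    then show "(LINT x|lebesgue. (u x - primitive v x) * vector_derivative \<phi> (at x)) = 0"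
      .
  qed
  then show ?thesis by (auto simp: algebra_simps elim!: eventually_mono)
qed

lemma weak_deriv_unique:
  assumes "has_weak_deriv u v" "has_weak_deriv u w"
  shows "AE x in lebesgue. v x = w x"
proof -
  have v: "locally_integrable v" and w: "locally_integrable w"
    using assms by (auto simp: has_weak_deriv_def)
  have "AE x in lebesgue. v x - w x = 0"
  proof (rule AE_zero_if_bump_integrals_zero[OF locally_integrable_diff[OF v w]])
    fix n a b :: real assume n: "n > 0"
    have supp: "bump n a b x = 0" if "x \<notin> {a..b}" for x
      using n that by (intro bump_outside) auto
    have "(LINT x|lebesgue. v x * bump n a b x) = (LINT x|lebesgue. w x * bump n a b x)"
      using assms test_function_bump[OF n, of a b] unfolding has_weak_deriv_def
      by (metis neg_equal_iff_equal)
    moreover have "integrable lebesgue (\<lambda>x. f x * bump n a b x)" if "locally_integrable f" for f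
      by (rule locally_integrable_mult_continuous[OF that smooth_imp_continuous[OF smooth_bump] supp])
    note this[OF v] this[OF w]
    ultimately show "(LINT x|lebesgue. (v x - w x) * bump n a b x) = 0"
      by (simp add: left_diff_distrib)
  qed
  then show ?thesis by simp
qed

lemma weak_deriv_works: "has_weak_deriv u v \<Longrightarrow> has_weak_deriv u (weak_deriv u)"
  unfolding weak_deriv_def by (rule someI[of "has_weak_deriv u"])

lemma has_weak_deriv_cong_AE:
  assumes "has_weak_deriv u v" "AE x in lebesgue. u x = u' x" "u' \<in> borel_measurable lebesgue"
  shows "has_weak_deriv u' v"
proof -
  have u: "locally_integrable u" using assms by (auto simp: has_weak_deriv_def)
  have u': "locally_integrable u'" by (rule locally_integrable_cong_AE[OF u assms(2,3)])
  have "(LINT x|lebesgue. u' x * vector_derivative \<phi> (at x)) = (LINT x|lebesgue. u x * vector_derivative \<phi> (at x))"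
    if \<phi>: "test_function \<phi>" for \<phi>
  proof -
    obtain R where "\<forall>x. x \<notin> {-R..R} \<longrightarrow> vector_derivative \<phi> (at x) = 0"
      using test_function_support[OF \<phi>] by blast
    then have supp: "\<And>x. x \<notin> {-R..R} \<Longrightarrow> vector_derivative \<phi> (at x) = 0"
      by simp
    let ?\<phi>' = "\<lambda>x. vector_derivative \<phi> (at x)"
    note cont = test_function_C1(3)[OF \<phi>]
    have int: "integrable lebesgue (\<lambda>x. f x * ?\<phi>' x)" if "locally_integrable f" for f
      by (rule locally_integrable_mult_continuous[OF that cont supp])
    have "(LINT x|lebesgue. u' x * ?\<phi>' x) = (LINT x|lebesgue. u x * ?\<phi>' x)"
    proof (rule integral_cong_AE)
      show "AE x in lebesgue. u' x * ?\<phi>' x = u x * ?\<phi>' x"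
        using assms(2) by eventually_elim simp
    qed (use int[OF u] int[OF u'] in \<open>auto dest: borel_measurable_integrable\<close>)
    then show ?thesis .
  qed
  then show ?thesis using assms(1) u' by (simp add: has_weak_deriv_def)
qed

lemma C1_has_weak_deriv:
  assumes d: "\<And>x. (u has_vector_derivative g x) (at x)" and g: "continuous_on UNIV g"
  shows "has_weak_deriv u g"
proof -
  have "u x - primitive g x = u 0 - primitive g 0" for x
  proof -
    have "((\<lambda>x. u x - primitive g x) has_vector_derivative 0) (at x within UNIV)" for x
      using has_vector_derivative_diff[OF d primitive_has_derivative[OF g]] by simp
    then obtain c where "\<And>x. x \<in> UNIV \<Longrightarrow> u x - primitive g x = c"
      by (rule has_vector_derivative_zero_constant[OF convex_UNIV]) blast
    then show ?thesis by simp
  qed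
  then have "u = (\<lambda>x. (u 0 - primitive g 0) + primitive g x)"
    by (auto simp: fun_eq_iff algebra_simps)
  then show ?thesis
    using primitive_has_weak_deriv[OF continuous_imp_locally_integrable[OF g]] by metis
qed

section \<open>From the operator to the differential equation\<close>

lemma continuous_AE_zero_imp_zero:
  fixes f :: "real \<Rightarrow> complex"
  assumes f: "continuous_on UNIV f" and ae: "AE x in lebesgue. f x = 0"
  shows "f x = 0"
proof (rule ccontr)
  assume "f x \<noteq> 0"
  have "open {x. f x \<noteq> 0}"
    using open_Collect_neq[OF f continuous_on_const] .
  moreover have "negligible {x. f x \<noteq> 0}"
    using ae by (simp add: negligible_iff_null_sets completion.AE_iff_null_sets AE_iff_null_sets)
  ultimately show False
    using \<open>f x \<noteq> 0\<close> open_not_negligible by blast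
qed

lemma bump_has_derivative:
  assumes "a < x" "x < b"
  shows "(bump 1 a b has_vector_derivative bump 1 a b x * of_real (1 / (x - a)\<^sup>2 - 1 / (b - x)\<^sup>2)) (at x)"
proof -
  let ?h = "flat_poly 1" and ?h' = "flat_poly ([:0, 0, 1:] * (1 - pderiv 1))"
  have h': "?h' y = ?h y * (1 / y\<^sup>2)" for y
    by (simp add: flat_poly_def pderiv_1 power2_eq_square)
  have "((\<lambda>x. ?h (x - a)) has_real_derivative ?h' (x - a) * 1) (at x)"
    by (rule DERIV_chain2[OF flat_poly_has_derivative]) (auto intro!: derivative_eq_intros)
  moreover have "((\<lambda>x. ?h (b - x)) has_real_derivative ?h' (b - x) * (-1)) (at x)"
    by (rule DERIV_chain2[OF flat_poly_has_derivative]) (auto intro!: derivative_eq_intros)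
  ultimately have "((\<lambda>x. ?h (x - a) * ?h (b - x)) has_real_derivative
      (?h' (x - a) * 1) * ?h (b - x) + (?h' (b - x) * (-1)) * ?h (x - a)) (at x)"
    by (rule DERIV_mult)
  moreover have "(?h' (x - a) * 1) * ?h (b - x) + (?h' (b - x) * (-1)) * ?h (x - a)
      = ?h (x - a) * ?h (b - x) * (1 / (x - a)\<^sup>2 - 1 / (b - x)\<^sup>2)"
    unfolding h' by (simp add: right_diff_distrib)
  ultimately have "((\<lambda>x. ?h (x - a) * ?h (b - x)) has_vector_derivative
      ?h (x - a) * ?h (b - x) * (1 / (x - a)\<^sup>2 - 1 / (b - x)\<^sup>2)) (at x)"
    by (simp only: has_real_derivative_iff_has_vector_derivative)
  from bounded_linear.has_vector_derivative[OF bounded_linear_of_real[where 'a = complex] this]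
  show ?thesis by (simp add: bump_def[abs_def])
qed

lemma smooth_bounded_continuous: "smooth_bounded f \<Longrightarrow> continuous_on UNIV f"
  by (simp add: smooth_bounded_def smooth_imp_continuous)

lemma weak_deriv_test_function:
  assumes "test_function \<phi>"
  shows "AE x in lebesgue. weak_deriv \<phi> x = vector_derivative \<phi> (at x)"
proof -
  have "has_weak_deriv \<phi> (\<lambda>x. vector_derivative \<phi> (at x))"
    by (rule C1_has_weak_deriv[OF test_function_C1(1,3)[OF assms]])
  from weak_deriv_unique[OF weak_deriv_works[OF this] this] show ?thesis .
qed

text \<open>After integration by parts, symmetry on \<open>\<phi>\<close> and \<open>\<psi>\<close> says that \<open>\<phi>\<close> integrates to zero against a
  combination \<open>B \<psi>\<close> of the conjugates of \<open>\<psi>'\<close> and \<open>\<psi>\<close>. As \<open>\<phi>\<close> is arbitrary, \<open>B \<psi>\<close> vanishes everywhere. At a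
  given point a bump with midpoint there has derivative zero, which kills the coefficient of \<open>\<psi>\<close>; an
  asymmetric bump then kills the coefficient of \<open>\<psi>'\<close>.\<close>

lemma formally_self_adjoint_coefficients:
  assumes a1: "smooth_bounded a1" and a0: "smooth_bounded a0"
    and sa: "formally_self_adjoint (\<lambda>u x. a1 x * Dx u x + a0 x * u x)"
  shows "Im (a1 x) = 0" "2 * Im (a0 x) = - Re (vector_derivative a1 (at x))"
proof -
  define a1' where "a1' x = vector_derivative a1 (at x)" for x
  have d1: "(a1 has_vector_derivative a1' x) (at x)" for x
    unfolding a1'_def by (rule smooth_bounded_deriv(1)[OF a1])
  have cont_a: "continuous_on UNIV a1" "continuous_on UNIV a0" "continuous_on UNIV a1'"
    using smooth_bounded_continuous a1 a0 smooth_bounded_deriv(2)[OF a1] by (auto simp: a1'_def[abs_def])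
  define B where "B \<psi> x = \<i> * (a1 x - cnj (a1 x)) * cnj (vector_derivative \<psi> (at x))
      + (\<i> * a1' x + a0 x - cnj (a0 x)) * cnj (\<psi> x)" for \<psi> x
  have B0: "B \<psi> x = 0" if \<psi>: "test_function \<psi>" for \<psi> x
  proof (rule continuous_AE_zero_imp_zero)
    note c\<psi> = test_function_C1(2,3)[OF \<psi>]
    show cB: "continuous_on UNIV (B \<psi>)"
      unfolding B_def by (intro continuous_intros cont_a c\<psi>)
    show "AE x in lebesgue. B \<psi> x = 0"
    proof (rule AE_zero_if_bump_integrals_zero[OF continuous_imp_locally_integrable[OF cB]])
      fix n a b :: real assume n: "n > 0"
      define \<phi> where "\<phi> = bump n a b"
      have \<phi>: "test_function \<phi>" unfolding \<phi>_def by (rule test_function_bump[OF n])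
      note c\<phi> = test_function_C1(2,3)[OF \<phi>]
      obtain R where "(\<forall>x. x \<notin> {-R<..<R} \<longrightarrow> \<phi> x = 0) \<and>
          (\<forall>x. x \<notin> {-R..R} \<longrightarrow> vector_derivative \<phi> (at x) = 0)"
        using test_function_support[OF \<phi>] by blast
      then have supp: "\<And>x. x \<notin> {-R<..<R} \<Longrightarrow> \<phi> x = 0"
          "\<And>x. x \<notin> {-R..R} \<Longrightarrow> vector_derivative \<phi> (at x) = 0"
        by simp_all
      have supp': "\<phi> x = 0" if "x \<notin> {-R..R}" for x using supp(1)[of x] that by auto
      let ?D\<phi> = "\<lambda>x. vector_derivative \<phi> (at x)" and ?D\<psi> = "\<lambda>x. vector_derivative \<psi> (at x)"
      let ?X1 = "\<lambda>x. (a1 x * cnj (\<psi> x)) * ?D\<phi> x"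
      let ?X2 = "\<lambda>x. (a1' x * cnj (\<psi> x) + a1 x * cnj (?D\<psi> x)) * \<phi> x"
      let ?X3 = "\<lambda>x. (a0 x * cnj (\<psi> x)) * \<phi> x"
      let ?X4 = "\<lambda>x. (cnj (a1 x * (- \<i> * ?D\<psi> x) + a0 x * \<psi> x)) * \<phi> x"
      have int: "integrable lebesgue (\<lambda>x. f x * \<phi> x)" "integrable lebesgue (\<lambda>x. f x * ?D\<phi> x)"
        if "continuous_on UNIV f" for f
        using locally_integrable_mult_continuous[OF continuous_imp_locally_integrable[OF that] c\<phi>(1) supp']
          locally_integrable_mult_continuous[OF continuous_imp_locally_integrable[OF that] c\<phi>(2) supp(2)]
        by auto
      have I: "integrable lebesgue ?X1" "integrable lebesgue ?X2" "integrable lebesgue ?X3" "integrable lebesgue ?X4"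
        by (intro int continuous_intros cont_a c\<psi>)+
      have "has_weak_deriv (\<lambda>x. a1 x * cnj (\<psi> x)) (\<lambda>x. a1' x * cnj (\<psi> x) + a1 x * cnj (?D\<psi> x))"
      proof (rule C1_has_weak_deriv)
        show "((\<lambda>x. a1 x * cnj (\<psi> x)) has_vector_derivative a1' x * cnj (\<psi> x) + a1 x * cnj (?D\<psi> x)) (at x)" for x
          using has_vector_derivative_mult[OF d1
              bounded_linear.has_vector_derivative[OF bounded_linear_cnj test_function_C1(1)[OF \<psi>]]]
          by (simp add: add.commute)
        show "continuous_on UNIV (\<lambda>x. a1' x * cnj (\<psi> x) + a1 x * cnj (?D\<psi> x))"
          by (intro continuous_intros cont_a c\<psi>)
      qed
      then have parts: "(LINT x|lebesgue. ?X1 x) = - (LINT x|lebesgue. ?X2 x)"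
        using \<phi> by (simp add: has_weak_deriv_def)
      have wd: "AE x in lebesgue. weak_deriv \<phi> x = ?D\<phi> x" "AE x in lebesgue. weak_deriv \<psi> x = ?D\<psi> x"
        using weak_deriv_test_function \<phi> \<psi> by auto
      have lhs: "(LINT x|lebesgue. (a1 x * Dx \<phi> x + a0 x * \<phi> x) * cnj (\<psi> x)) = (LINT x|lebesgue. - \<i> * ?X1 x + ?X3 x)"
      proof (rule integral_cong_AE)
        show ae: "AE x in lebesgue. (a1 x * Dx \<phi> x + a0 x * \<phi> x) * cnj (\<psi> x) = - \<i> * ?X1 x + ?X3 x"
          using wd(1) by eventually_elim (simp add: Dx_def algebra_simps)
        show m: "(\<lambda>x. - \<i> * ?X1 x + ?X3 x) \<in> borel_measurable lebesgue"
          using I by (intro borel_measurable_integrable Bochner_Integration.integrable_add integrable_mult_right)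
        show "(\<lambda>x. (a1 x * Dx \<phi> x + a0 x * \<phi> x) * cnj (\<psi> x)) \<in> borel_measurable lebesgue"
          by (rule borel_measurable_AE[OF m]) (use ae in \<open>auto elim: eventually_mono\<close>)
      qed
      have rhs: "(LINT x|lebesgue. \<phi> x * cnj (a1 x * Dx \<psi> x + a0 x * \<psi> x)) = (LINT x|lebesgue. ?X4 x)"
      proof (rule integral_cong_AE)
        show ae: "AE x in lebesgue. \<phi> x * cnj (a1 x * Dx \<psi> x + a0 x * \<psi> x) = ?X4 x"
          using wd(2) by eventually_elim (simp add: Dx_def mult.commute)
        show m: "?X4 \<in> borel_measurable lebesgue"
          using I by (intro borel_measurable_integrable)
        show "(\<lambda>x. \<phi> x * cnj (a1 x * Dx \<psi> x + a0 x * \<psi> x)) \<in> borel_measurable lebesgue"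
          by (rule borel_measurable_AE[OF m]) (use ae in \<open>auto elim: eventually_mono\<close>)
      qed
      have "(LINT x|lebesgue. - \<i> * ?X1 x + ?X3 x) = (LINT x|lebesgue. ?X4 x)"
        using sa \<phi> \<psi> unfolding formally_self_adjoint_def lhs[symmetric] rhs[symmetric] by blast
      then have "\<i> * (LINT x|lebesgue. ?X2 x) + (LINT x|lebesgue. ?X3 x) - (LINT x|lebesgue. ?X4 x) = 0"
        using I parts by (simp add: add.commute del: complex_cnj_mult complex_cnj_add)
      moreover have "B \<psi> x * \<phi> x = \<i> * ?X2 x + ?X3 x - ?X4 x" for x
        by (simp add: B_def algebra_simps)
      ultimately show "(LINT x|lebesgue. B \<psi> x * bump n a b x) = 0"
        using I by (simp add: \<phi>_def[symmetric] del: complex_cnj_mult complex_cnj_add)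
    qed
  qed
  \<comment> \<open>A bump that reaches \<open>1\<close> to the left of \<open>x\<close> and \<open>c\<close> to the right; its logarithmic derivative at \<open>x\<close> is \<open>1 - 1 / c\<^sup>2\<close>.\<close>
  have ev: "\<i> * (a1 x - cnj (a1 x)) * of_real (1 - 1 / c\<^sup>2) + (\<i> * a1' x + a0 x - cnj (a0 x)) = 0"
    if "c > 0" for c
  proof -
    let ?b = "bump 1 (x - 1) (x + c)"
    have "(?b has_vector_derivative ?b x * of_real (1 / (x - (x - 1))\<^sup>2 - 1 / (x + c - x)\<^sup>2)) (at x)"
      by (rule bump_has_derivative) (use that in auto)
    then have d: "vector_derivative ?b (at x) = ?b x * of_real (1 - 1 / c\<^sup>2)"
      using vector_derivative_at by fastforce
    have real: "cnj (?b x) = ?b x" by (simp add: bump_def)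
    have nz: "?b x \<noteq> 0" using that by (simp add: bump_inside)
    have "?b x * (\<i> * (a1 x - cnj (a1 x)) * of_real (1 - 1 / c\<^sup>2) + (\<i> * a1' x + a0 x - cnj (a0 x)))
        = B ?b x"
      unfolding B_def d complex_cnj_mult real complex_cnj_complex_of_real
      by (simp add: algebra_simps diff_divide_distrib)
    then show ?thesis using B0[OF test_function_bump, of 1 "x - 1" "x + c" x] nz by simp
  qed
  from ev[of 1] have e1: "\<i> * a1' x + a0 x - cnj (a0 x) = 0" by simp
  with ev[of 2] have "a1 x - cnj (a1 x) = 0" by simp
  then show "Im (a1 x) = 0" by (simp add: complex_eq_iff)
  show "2 * Im (a0 x) = - Re (vector_derivative a1 (at x))"
    using e1 by (simp add: complex_eq_iff a1'_def)
qed

text \<open>Both \<open>u\<close> and its weak derivative \<open>v\<close> agree almost everywhere with continuous primitives \<open>U\<close> and \<open>Y\<close>.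
  By the equation the weak derivative of \<open>v\<close> then agrees with a continuous function, so its primitive
  \<open>Y\<close> is continuously differentiable, and so is \<open>U\<close>, the primitive of \<open>Y\<close>.\<close>

lemma eigenfunction_regular:
  assumes a: "continuous_on UNIV a1" "continuous_on UNIV a0"
    and u: "nontrivial_eigenfunction (H (\<lambda>u x. a1 x * Dx u x + a0 x * u x)) z u"
  obtains U Y where "AE x in lebesgue. u x = U x"
    "\<And>x. (U has_vector_derivative Y x) (at x)"
    "\<And>x. (Y has_vector_derivative (a0 x - z) * U x - \<i> * a1 x * Y x) (at x)"
    "integrable lborel (\<lambda>x. (norm (U x))\<^sup>2)" "integrable lborel (\<lambda>x. (norm (Y x))\<^sup>2)"
proof -
  obtain v0 w0 where uL: "u \<in> L2" and vL: "v0 \<in> L2" and uv0: "has_weak_deriv u v0" and vw0: "has_weak_deriv v0 w0"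
    using u unfolding nontrivial_eigenfunction_def H2_def by blast
  define v where "v = weak_deriv u"
  define w where "w = weak_deriv v"
  have uv: "has_weak_deriv u v" unfolding v_def by (rule weak_deriv_works[OF uv0])
  have v0v: "AE x in lebesgue. v0 x = v x" by (rule weak_deriv_unique[OF uv0 uv])
  have "v \<in> borel_measurable lebesgue"
    using uv locally_integrable_measurable by (auto simp: has_weak_deriv_def)
  then have "has_weak_deriv v w0" by (rule has_weak_deriv_cong_AE[OF vw0 v0v])
  then have vw: "has_weak_deriv v w" unfolding w_def by (rule weak_deriv_works)
  have lv: "locally_integrable v" and lw: "locally_integrable w"
    using vw by (auto simp: has_weak_deriv_def)
  obtain c1 where c1: "AE x in lebesgue. u x = c1 + primitive v x"
    using has_weak_deriv_imp_primitive[OF uv] by blast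
  obtain c2 where c2: "AE x in lebesgue. v x = c2 + primitive w x"
    using has_weak_deriv_imp_primitive[OF vw] by blast
  define U where "U x = c1 + primitive v x" for x
  define Y where "Y x = c2 + primitive w x" for x
  define g where "g x = (a0 x - z) * U x - \<i> * a1 x * Y x" for x
  have cU: "continuous_on UNIV U" and cY: "continuous_on UNIV Y"
    unfolding U_def Y_def by (intro continuous_intros continuous_primitive lv lw)+
  have cg: "continuous_on UNIV g"
    unfolding g_def by (intro continuous_intros a cU cY)
  have uU: "AE x in lebesgue. u x = U x" and vY: "AE x in lebesgue. v x = Y x"
    using c1 c2 by (simp_all add: U_def Y_def)
  have "AE x in lebesgue. - w x + (a1 x * (- \<i> * v x) + a0 x * u x) = z * u x"
    using u by (simp add: nontrivial_eigenfunction_def H_def Dx_def v_def w_def)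
  then have wg: "AE x in lebesgue. w x = g x"
    using uU vY by eventually_elim (simp add: g_def algebra_simps)
  have "primitive v = primitive Y" by (rule primitive_cong_AE[OF vY])
  then have dU: "(U has_vector_derivative Y x) (at x)" for x
    using has_vector_derivative_add[OF has_vector_derivative_const primitive_has_derivative[OF cY]]
    by (simp add: U_def[abs_def])
  have "primitive w = primitive g" by (rule primitive_cong_AE[OF wg])
  then have dY: "(Y has_vector_derivative g x) (at x)" for x
    using has_vector_derivative_add[OF has_vector_derivative_const primitive_has_derivative[OF cg]]
    by (simp add: Y_def[abs_def])
  have sq: "integrable lborel (\<lambda>x. (norm (F x))\<^sup>2)"
    if F: "continuous_on UNIV F" and f: "f \<in> L2" "AE x in lebesgue. f x = F x" for f F :: "real \<Rightarrow> complex"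
  proof -
    have m: "(\<lambda>x. (norm (F x))\<^sup>2) \<in> borel_measurable borel"
      by (intro borel_measurable_continuous_onI continuous_intros F)
    have "integrable lebesgue (\<lambda>x. (norm (F x))\<^sup>2)"
    proof (rule integrable_cong_AE_imp)
      show "integrable lebesgue (\<lambda>x. (norm (f x))\<^sup>2)" using f(1) by (simp add: L2_def)
      show "(\<lambda>x. (norm (F x))\<^sup>2) \<in> borel_measurable lebesgue"
        by (rule borel_imp_lebesgue_measurable[OF m])
      show "AE x in lebesgue. (norm (f x))\<^sup>2 = (norm (F x))\<^sup>2"
        using f(2) by eventually_elim simp
    qed
    then show ?thesis using m by (simp add: integrable_completion)
  qed
  have "AE x in lebesgue. v0 x = Y x"
    using v0v vY by eventually_elim simp
  then have "integrable lborel (\<lambda>x. (norm (Y x))\<^sup>2)" by (rule sq[OF cY vL])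
  moreover have "integrable lborel (\<lambda>x. (norm (U x))\<^sup>2)" by (rule sq[OF cU uL uU])
  ultimately show ?thesis
    using that[OF uU dU dY[unfolded g_def]] by blast
qed

section \<open>The decay estimate\<close>

theorem corollary1p19:
  fixes Q :: "(real \<Rightarrow> complex) \<Rightarrow> real \<Rightarrow> complex" and N :: nat
  assumes "Q \<in> Diff1" and "formally_self_adjoint Q"
  shows "\<exists>C::real. C > 0 \<and>
    (\<forall>(\<rho>::real) (u :: real \<Rightarrow> complex).
        \<rho> > 1 \<longrightarrow> nontrivial_eigenfunction (H Q) (complex_of_real (\<rho>\<^sup>2)) u \<longrightarrow>
        Linf_norm u / ereal (L2_norm u) \<le> ereal (C * \<rho> powi (- int N)))"
proof -
  obtain a1 a0 where a1: "smooth_bounded a1" and a0: "smooth_bounded a0"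
    and Q: "Q = (\<lambda>u x. a1 x * Dx u x + a0 x * u x)"
    using assms(1) by (auto simp: Diff1_def)
  note coeffs = formally_self_adjoint_coefficients[OF a1 a0 assms(2)[unfolded Q]]
  define b where "b x = Re (a1 x) / 2" for x
  define b' where "b' x = Re (vector_derivative a1 (at x)) / 2" for x
  define V where "V x = Re (a0 x) - b x * b x" for x
  have a1_eq: "a1 x = 2 * of_real (b x)" for x
    using coeffs(1)[of x] by (simp add: b_def complex_eq_iff)
  have a0_eq: "a0 x = of_real (V x + b x * b x) - \<i> * of_real (b' x)" for x
    using coeffs(2)[of x] by (simp add: V_def b'_def complex_eq_iff)
  have db: "(b has_vector_derivative b' x) (at x)" for x
    using bounded_linear.has_vector_derivative[OF bounded_linear_Re smooth_bounded_deriv(1)[OF a1, of x]]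
    unfolding b_def[abs_def] b'_def by (rule has_vector_derivative_divide)
  have us_b: "uniformly_smooth {0..1::real} (\<lambda>_. b)"
  proof -
    have "uniformly_smooth {0..1::real} (\<lambda>_ x. (1 / 2) * Re (a1 x))"
      by (intro uniformly_smooth_mult uniformly_smooth_const[OF order_refl]
          uniformly_smooth_bounded_linear[OF bounded_linear_Re] smooth_bounded_imp_uniformly_smooth[OF a1])
    then show ?thesis by (simp add: b_def[abs_def])
  qed
  have us_V: "uniformly_smooth {0..1::real} (\<lambda>_. V)"
  proof -
    have "uniformly_smooth {0..1::real} (\<lambda>_ x. Re (a0 x) - b x * b x)"
      by (intro uniformly_smooth_diff uniformly_smooth_mult us_b
          uniformly_smooth_bounded_linear[OF bounded_linear_Re] smooth_bounded_imp_uniformly_smooth[OF a0])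
    then show ?thesis by (simp add: V_def[abs_def])
  qed
  obtain Mb where Mb: "\<And>e x. e \<in> {0..1::real} \<Longrightarrow> norm (b x) \<le> Mb"
    using uniformly_smooth_bounded[OF us_b] by blast
  obtain C where "C > 0" and C: "\<And>\<Lambda> U W b x. \<Lambda> > 1 \<Longrightarrow> covariant_solution U W b V \<Lambda> \<Longrightarrow>
     (norm (U x))\<^sup>2 \<le> C * (1 / \<Lambda>) ^ N * (LBINT x. (norm (U x))\<^sup>2)"
    using sup_bound_all_energies[OF us_V, of N] by blast
  have "Linf_norm u / ereal (L2_norm u) \<le> ereal (sqrt C * \<rho> powi (- int N))"
    if \<rho>: "\<rho> > 1" and u: "nontrivial_eigenfunction (H Q) (complex_of_real (\<rho>\<^sup>2)) u" for \<rho> u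
  proof -
    obtain U Y where uU: "AE x in lebesgue. u x = U x"
      and dU: "\<And>x. (U has_vector_derivative Y x) (at x)"
      and dY: "\<And>x. (Y has_vector_derivative (a0 x - complex_of_real (\<rho>\<^sup>2)) * U x - \<i> * a1 x * Y x) (at x)"
      and U2: "integrable lborel (\<lambda>x. (norm (U x))\<^sup>2)" and Y2: "integrable lborel (\<lambda>x. (norm (Y x))\<^sup>2)"
      using eigenfunction_regular[OF smooth_bounded_continuous[OF a1] smooth_bounded_continuous[OF a0] u[unfolded Q]]
      by blast
    \<comment> \<open>The covariant derivative, in which the first-order term of the equation is absorbed.\<close>
    define W where "W x = Y x + \<i> * b x * U x" for x
    \<comment> \<open>The imaginary part of \<open>a\<^sub>0\<close> cancels against the derivative of \<open>b\<close>.\<close>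
    have dW: "(W has_vector_derivative (V x - \<rho>\<^sup>2) * U x - \<i> * b x * W x) (at x)" for x
    proof -
      have dbc: "((\<lambda>x. complex_of_real (b x)) has_vector_derivative complex_of_real (b' x)) (at x)"
        by (rule bounded_linear.has_vector_derivative[OF bounded_linear_of_real db])
      have "(W has_vector_derivative ((a0 x - complex_of_real (\<rho>\<^sup>2)) * U x - \<i> * a1 x * Y x)
          + \<i> * (b x * Y x + b' x * U x)) (at x)"
        using has_vector_derivative_add[OF dY has_vector_derivative_mult_right[OF
            has_vector_derivative_mult[OF dbc dU], of \<i>]]
        by (simp add: W_def[abs_def] mult.assoc)
      moreover have "((a0 x - complex_of_real (\<rho>\<^sup>2)) * U x - \<i> * a1 x * Y x) + \<i> * (b x * Y x + b' x * U x)
          = (V x - \<rho>\<^sup>2) * U x - \<i> * b x * W x"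
        unfolding a0_eq a1_eq W_def by (simp add: algebra_simps)
      ultimately show ?thesis by simp
    qed
    have cY: "continuous_on UNIV Y" and cU: "continuous_on UNIV U" and cb: "continuous_on UNIV b"
      using has_vector_derivative_continuous[OF dY] has_vector_derivative_continuous[OF dU]
        has_vector_derivative_continuous[OF db]
      by (auto simp: continuous_on_eq_continuous_at)
    have W2: "integrable lborel (\<lambda>x. (norm (W x))\<^sup>2)"
    proof (rule Bochner_Integration.integrable_bound)
      show "integrable lborel (\<lambda>x. 2 * (norm (Y x))\<^sup>2 + 2 * Mb\<^sup>2 * (norm (U x))\<^sup>2)"
        using U2 Y2 by simp
      have "continuous_on UNIV (\<lambda>x. (norm (W x))\<^sup>2)"
        unfolding W_def by (intro continuous_intros cY cU cb)
      then show "(\<lambda>x. (norm (W x))\<^sup>2) \<in> borel_measurable lborel"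
        using borel_measurable_continuous_onI by simp
      show "AE x in lborel. norm ((norm (W x))\<^sup>2) \<le> norm (2 * (norm (Y x))\<^sup>2 + 2 * Mb\<^sup>2 * (norm (U x))\<^sup>2)"
      proof (intro AE_I2)
        fix x
        have "norm (W x) \<le> norm (Y x) + \<bar>b x\<bar> * norm (U x)"
          unfolding W_def by (rule norm_triangle_le) (simp add: norm_mult)
        also have "\<dots> \<le> norm (Y x) + Mb * norm (U x)"
          using Mb[of 0 x] by (intro add_left_mono mult_right_mono) auto
        finally have "(norm (W x))\<^sup>2 \<le> (norm (Y x) + Mb * norm (U x))\<^sup>2"
          by (intro power_mono) auto
        also have "\<dots> \<le> 2 * (norm (Y x))\<^sup>2 + 2 * Mb\<^sup>2 * (norm (U x))\<^sup>2"
          using sum_squares_bound[of "norm (Y x)" "Mb * norm (U x)"]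
          by (simp add: power2_sum power_mult_distrib)
        finally show "norm ((norm (W x))\<^sup>2) \<le> norm (2 * (norm (Y x))\<^sup>2 + 2 * Mb\<^sup>2 * (norm (U x))\<^sup>2)"
          by simp
      qed
    qed
    have sol: "covariant_solution U W b V (\<rho>\<^sup>2)"
    proof
      show "(U has_vector_derivative W x - \<i> * b x * U x) (at x)" for x
        using dU[of x] by (simp add: W_def)
    qed (use dW U2 W2 in auto)
    let ?I = "LBINT x. (norm (U x))\<^sup>2"
    let ?B = "sqrt C * \<rho> powi (- int N)"
    have L2: "L2_norm u = sqrt ?I"
    proof -
      have m: "(\<lambda>x. (norm (U x))\<^sup>2) \<in> borel_measurable borel"
        by (intro borel_measurable_continuous_onI continuous_intros cU)
      have um: "u \<in> borel_measurable lebesgue"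
        using u by (simp add: nontrivial_eigenfunction_def H2_def L2_def)
      have "(LINT x|lebesgue. (norm (u x))\<^sup>2) = (LINT x|lebesgue. (norm (U x))\<^sup>2)"
        using uU um borel_imp_lebesgue_measurable[OF m]
        by (intro integral_cong_AE) (auto elim!: eventually_mono)
      also have "\<dots> = ?I" using m by (intro integral_completion) simp
      finally show ?thesis by (simp add: L2_norm_def)
    qed
    have B: "norm (U x) \<le> ?B * sqrt ?I" for x
    proof -
      have "\<rho>\<^sup>2 > 1" using \<rho> by (simp add: one_less_power)
      then have "(norm (U x))\<^sup>2 \<le> C * (1 / \<rho>\<^sup>2) ^ N * ?I" using C[OF _ sol] by blast
      also have "\<dots> = (?B * sqrt ?I)\<^sup>2"
      proof -
        have "\<rho> powi (- int N) = (1 / \<rho>) ^ N"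
          by (simp add: power_int_minus power_one_over inverse_eq_divide)
        moreover have "(1 / \<rho>\<^sup>2) ^ N = ((1 / \<rho>) ^ N)\<^sup>2"
          by (metis power_commutes power_mult power_one_over mult.commute)
        moreover have "?I \<ge> 0" by simp
        ultimately show ?thesis
          using \<open>C > 0\<close> by (simp only: power_mult_distrib real_sqrt_pow2 less_imp_le)
      qed
      finally show ?thesis
        by (rule power2_le_imp_le) (use \<open>C > 0\<close> \<rho> in simp)
    qed
    have L2_pos: "L2_norm u > 0"
    proof (rule ccontr)
      assume "\<not> L2_norm u > 0"
      then have "sqrt ?I \<le> 0" using L2 by simp
      moreover have "0 \<le> sqrt ?I" by simp
      ultimately have "sqrt ?I = 0" by (rule antisym)
      then have "U x = 0" for x using B[of x] by (simp only: mult_zero_right norm_le_zero_iff)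
      then have "AE x in lebesgue. u x = 0" using uU by simp
      then show False using u by (simp add: nontrivial_eigenfunction_def)
    qed
    have "Linf_norm u \<le> ereal (?B * L2_norm u)"
      unfolding Linf_norm_def
    proof (rule esssup_I)
      have "u \<in> borel_measurable lebesgue"
        using u by (simp add: nontrivial_eigenfunction_def H2_def L2_def)
      then show "(\<lambda>x. ereal (norm (u x))) \<in> borel_measurable lebesgue" by measurable
      show "AE x in lebesgue. ereal (norm (u x)) \<le> ereal (?B * L2_norm u)"
        using uU by eventually_elim (use B L2 in simp)
    qed
    then have "Linf_norm u / ereal (L2_norm u) \<le> ereal (?B * L2_norm u) / ereal (L2_norm u)"
      using L2_pos by (intro ereal_divide_right_mono) auto
    also have "\<dots> = ereal ?B" using L2_pos by simp
    finally show ?thesis .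
  qed
  then show ?thesis using \<open>C > 0\<close> by (intro exI[of _ "sqrt C"]) auto
qed

end
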